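(* Let $T>0$, $\beta\in(\frac12,1]$, $\alpha\in(\frac12,\beta)$, let $\mathcal V,\mathcal W,\mathcal X$ be Banach spaces and let $\sigma\colon\mathbb R\times\mathcal W\times\mathcal X\to\mathcal L(\mathcal V,\mathcal X)$ be an $\alpha$-nice function satisfying also the optional condition (d) (see context). Let $$\Psi_\alpha\colon C^\beta([0,T],\mathcal V)\times C^\alpha([0,T],\mathcal W)\times\mathcal X\to C^\alpha([0,T],\mathcal X),\qquad(g,w,a)\mapsto\Psi_\alpha(g,w,a),$$ be the map sending the driving signal $g$, the parameters $w$ and the initial condition $a$ to the unique solution $x\in C^\alpha([0,T],\mathcal X)$ of the Young differential equation $dx_t=\sigma(t,w_t,x_t)\,dg_t$ on $[0,T]$ with $x_0=a$. Then $\Psi_\alpha$ is locally Lipschitz continuous, where the domain is equipped with the norm $\|(g,w,a)\|=\|g\|_\beta+\|w\|_\alpha+|a|$. If $\sigma$ is $\alpha$-nice but the optional condition (d) is not assumed, then $\Psi_\alpha$ is still locally Lipschitz continuous in $g$ and $a$ (for fixed $w$).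
   Context: **Norms.** $|\cdot|$ denotes norms of vectors in Banach spaces (operator norm on $\mathcal L(\cdot,\cdot)$, the bounded linear operators). For a Banach-space-valued $f$ on $[0,T]$ and $\alpha\in(0,1]$: $[f]_\alpha=\sup_{s\ne t}\frac{|f_t-f_s|}{|t-s|^\alpha}$, $\|f\|_\alpha=\sup_s|f_s|+[f]_\alpha$. $C^\alpha([0,T],\mathcal E)$ is the space of $f\colon[0,T]\to\mathcal E$ with $\|f\|_\alpha<\infty$. **$\alpha$-nice function.** $\sigma\colon\mathbb R\times\mathcal W\times\mathcal X\to\mathcal L(\mathcal V,\mathcal X)$ is $\alpha$-nice if: (a) $\|\sigma\|_\infty<\infty$; (b) $\sigma$ is Fréchet differentiable in $x$, and there is a continuous $c\colon\mathbb R^3\to[0,\infty)$ such that both $F=\sigma$ and $F=D_x\sigma$ satisfy $|F(t,w,x)-F(t,\tilde w,\tilde x)|\le c(t,|w|,|\tilde w|)\bigl(|x-\tilde x|+(1+|x|+|\tilde x|)|w-\tilde w|\bigr)$; (c) there is a continuous $\mathsf c\colon\mathbb R\to[0,\infty)$ such that both $F=\sigma$ and $F=D_x\sigma$ satisfy $|F(t,w,x)-F(s,w,x)|\le\mathsf c(|w|)(1+|x|)|t-s|^\alpha$. **Optional condition (d).** $\sigma$ is Fréchet differentiable in $w$ and there are continuous $\tilde c\colon\mathbb R^5\to[0,\infty)$ and $\tilde{\mathsf c}\colon\mathbb R^2\to[0,\infty)$ with $|D_w\sigma(t,w,x)-D_w\sigma(t,\tilde w,\tilde x)|\le\tilde c(t,|w|,|\tilde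 w|,|x|,|\tilde x|)\bigl(|x-\tilde x|+|w-\tilde w|\bigr)$ and $|D_w\sigma(t,w,x)-D_w\sigma(s,w,x)|\le\tilde{\mathsf c}(|w|,|x|)|t-s|^\alpha$. **Solution.** $x\in C^\alpha([0,T],\mathcal X)$ solves the equation if $x_t=a+\int_0^t\sigma(s,w_s,x_s)\,dg_s$ for all $t\in[0,T]$, with the Young integral $\int_0^t\sigma(s,w_s,x_s)\,dg_s=\lim_{|\pi|\to0}\sum_{[u,v]\in\pi}\sigma(u,w_u,x_u)(g_v-g_u)$ over partitions $\pi$ of $[0,t]$ with mesh $|\pi|\to0$. Under condition (a)–(c) a unique solution exists for all such $(g,w,a)$. *)

theory Defs
  imports "HOL-Analysis.Analysis"
begin

definition sup_norm :: "real \<Rightarrow> (real \<Rightarrow> 'e::real_normed_vector) \<Rightarrow> real" where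
  "sup_norm T f = (SUP s\<in>{0..T}. norm (f s))"

definition holder_quotients ::
    "real \<Rightarrow> real \<Rightarrow> (real \<Rightarrow> 'e::real_normed_vector) \<Rightarrow> real set" where
  "holder_quotients \<alpha> T f =
     {norm (f t - f s) / \<bar>t - s\<bar> powr \<alpha> | s t. s \<in> {0..T} \<and> t \<in> {0..T} \<and> s \<noteq> t}"

definition holder_norm :: "real \<Rightarrow> real \<Rightarrow> (real \<Rightarrow> 'e::real_normed_vector) \<Rightarrow> real" where
  "holder_norm \<alpha> T f = sup_norm T f + Sup (holder_quotients \<alpha> T f)"

(* A function on [0,T] is represented by its extension by 0 to the real line, so that equality
   is equality on [0,T] and the space is closed under the pointwise operations.
   The two bdd_above conditions say that the real-valued suprema in holder_norm are
   genuine, i.e. that the Hoelder norm is finite. *)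
definition holder_space :: "real \<Rightarrow> real \<Rightarrow> (real \<Rightarrow> 'e::real_normed_vector) set" where
  "holder_space \<alpha> T =
     {f. (\<forall>t. t \<notin> {0..T} \<longrightarrow> f t = 0) \<and>
         bdd_above ((\<lambda>s. norm (f s)) ` {0..T}) \<and>
         bdd_above (holder_quotients \<alpha> T f)}"

(* The two estimates in (b) and (c), as properties of a map F with values in an arbitrary normed
   space, so that they apply both to sigma and to its derivative in x. *)
definition nice_space_bound ::
    "(real \<times> real \<times> real \<Rightarrow> real) \<Rightarrow>
     (real \<Rightarrow> 'w::real_normed_vector \<Rightarrow> 'x::real_normed_vector \<Rightarrow> 'e::real_normed_vector) \<Rightarrow> bool"
  where
  "nice_space_bound c F \<longleftrightarrow>
     (\<forall>t w w' x x'. norm (F t w x - F t w' x') \<le>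
        c (t, norm w, norm w') * (norm (x - x') + (1 + norm x + norm x') * norm (w - w')))"

definition nice_time_bound ::
    "real \<Rightarrow> (real \<Rightarrow> real) \<Rightarrow>
     (real \<Rightarrow> 'w::real_normed_vector \<Rightarrow> 'x::real_normed_vector \<Rightarrow> 'e::real_normed_vector) \<Rightarrow> bool"
  where
  "nice_time_bound \<alpha> c F \<longleftrightarrow>
     (\<forall>t s w x. norm (F t w x - F s w x) \<le> c (norm w) * (1 + norm x) * \<bar>t - s\<bar> powr \<alpha>)"

definition alpha_nice ::
    "real \<Rightarrow> (real \<Rightarrow> 'w::banach \<Rightarrow> 'x::banach \<Rightarrow> ('v::banach \<Rightarrow>\<^sub>L 'x)) \<Rightarrow> bool" where
  "alpha_nice \<alpha> \<sigma> \<longleftrightarrow>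
     (\<exists>M. \<forall>t w x. norm (\<sigma> t w x) \<le> M) \<and>
     (\<exists>D :: real \<Rightarrow> 'w \<Rightarrow> 'x \<Rightarrow> ('x \<Rightarrow>\<^sub>L ('v \<Rightarrow>\<^sub>L 'x)).
        (\<forall>t w x. ((\<lambda>y. \<sigma> t w y) has_derivative blinfun_apply (D t w x)) (at x)) \<and>
        (\<exists>c. continuous_on UNIV c \<and> (\<forall>p. 0 \<le> c p) \<and>
             nice_space_bound c \<sigma> \<and> nice_space_bound c D) \<and>
        (\<exists>c. continuous_on UNIV c \<and> (\<forall>r. 0 \<le> c r) \<and>
             nice_time_bound \<alpha> c \<sigma> \<and> nice_time_bound \<alpha> c D))"

definition nice_condition_d ::
    "real \<Rightarrow> (real \<Rightarrow> 'w::banach \<Rightarrow> 'x::banach \<Rightarrow> ('v::banach \<Rightarrow>\<^sub>L 'x)) \<Rightarrow> bool" where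
  "nice_condition_d \<alpha> \<sigma> \<longleftrightarrow>
     (\<exists>D :: real \<Rightarrow> 'w \<Rightarrow> 'x \<Rightarrow> ('w \<Rightarrow>\<^sub>L ('v \<Rightarrow>\<^sub>L 'x)).
        (\<forall>t w x. ((\<lambda>z. \<sigma> t z x) has_derivative blinfun_apply (D t w x)) (at w)) \<and>
        (\<exists>c :: real \<times> real \<times> real \<times> real \<times> real \<Rightarrow> real.
           continuous_on UNIV c \<and> (\<forall>p. 0 \<le> c p) \<and>
           (\<forall>t w w' x x'. norm (D t w x - D t w' x') \<le>
              c (t, norm w, norm w', norm x, norm x') * (norm (x - x') + norm (w - w')))) \<and>
        (\<exists>c :: real \<times> real \<Rightarrow> real.
           continuous_on UNIV c \<and> (\<forall>p. 0 \<le> c p) \<and>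
           (\<forall>t s w x. norm (D t w x - D s w x) \<le> c (norm w, norm x) * \<bar>t - s\<bar> powr \<alpha>)))"

(* Partitions are divisions \<pi> of [a,b] into compact intervals K = [Inf K, Sup K], with left-point
   evaluation. Degenerate intervals, which division_of permits, contribute 0. *)
definition has_young_integral ::
    "(real \<Rightarrow> ('v::real_normed_vector \<Rightarrow>\<^sub>L 'x::real_normed_vector)) \<Rightarrow> (real \<Rightarrow> 'v) \<Rightarrow>
     real \<Rightarrow> real \<Rightarrow> 'x \<Rightarrow> bool" where
  "has_young_integral f g a b I \<longleftrightarrow>
     (\<forall>\<epsilon>>0. \<exists>\<delta>>0. \<forall>\<pi>. \<pi> division_of {a..b} \<and> (\<forall>K\<in>\<pi>. Sup K - Inf K < \<delta>) \<longrightarrow>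
        norm ((\<Sum>K\<in>\<pi>. blinfun_apply (f (Inf K)) (g (Sup K) - g (Inf K))) - I) < \<epsilon>)"

definition young_solution ::
    "real \<Rightarrow> real \<Rightarrow> (real \<Rightarrow> 'w::banach \<Rightarrow> 'x::banach \<Rightarrow> ('v::banach \<Rightarrow>\<^sub>L 'x)) \<Rightarrow>
     (real \<Rightarrow> 'v) \<Rightarrow> (real \<Rightarrow> 'w) \<Rightarrow> 'x \<Rightarrow> (real \<Rightarrow> 'x) \<Rightarrow> bool" where
  "young_solution \<alpha> T \<sigma> g w a x \<longleftrightarrow>
     x \<in> holder_space \<alpha> T \<and>
     (\<forall>t\<in>{0..T}. \<exists>I. has_young_integral (\<lambda>s. \<sigma> s (w s) (x s)) g 0 t I \<and> x t = a + I)"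

definition young_solution_map ::
    "real \<Rightarrow> real \<Rightarrow> (real \<Rightarrow> 'w::banach \<Rightarrow> 'x::banach \<Rightarrow> ('v::banach \<Rightarrow>\<^sub>L 'x)) \<Rightarrow>
     (real \<Rightarrow> 'v) \<Rightarrow> (real \<Rightarrow> 'w) \<Rightarrow> 'x \<Rightarrow> (real \<Rightarrow> 'x)" where
  "young_solution_map \<alpha> T \<sigma> g w a = (THE x. young_solution \<alpha> T \<sigma> g w a x)"

(* Every point of S has a neighbourhood in S on which f is Lipschitz, for a norm N on S
   and a norm N' on the target, given as functions because the Hoelder spaces are sets, not types. *)
definition locally_lipschitz_map ::
    "'a::minus set \<Rightarrow> ('a \<Rightarrow> real) \<Rightarrow> ('b::minus \<Rightarrow> real) \<Rightarrow> ('a \<Rightarrow> 'b) \<Rightarrow> bool" where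
  "locally_lipschitz_map S N N' f \<longleftrightarrow>
     (\<forall>p\<in>S. \<exists>r>0. \<exists>L. \<forall>q\<in>S. \<forall>q'\<in>S. N (q - p) < r \<and> N (q' - p) < r \<longrightarrow>
        N' (f q - f q') \<le> L * N (q - q'))"

end

theory Submission
  imports Defs
begin

text \<open>
The Young differential equation \<open>dx = \<sigma>(t, w, x) dg\<close> is well posed because integration against a
\<open>\<beta>\<close>-Hoelder driver, measured in \<open>\<alpha>\<close>-Hoelder norms with \<open>\<alpha> < \<beta>\<close>, gains a factor
\<open>h powr (\<beta> - \<alpha>)\<close> on time intervals of length \<open>h\<close>.

Integrals are handled through their increments. By the sewing lemma (\<open>sewing\<close>), every integrand \<open>f\<close> of
order \<open>\<alpha>\<close> has an indefinite integral \<open>y\<close> with \<open>y t - y s = f s (g t - g s)\<close> up to an error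
\<open>C * (t - s) powr (\<alpha> + \<beta>)\<close>, and this property characterises it. Hence \<open>x\<close> solves the equation iff
\<open>x 0 = a\<close> and the increments of \<open>x\<close> agree up to such an error with
\<open>\<sigma>(s, w s, x s) (g t - g s)\<close> (\<open>young_solution_iff_follows_germ\<close>). This form is linear, stable under
pointwise limits, and self-improving: bisection replaces the unknown constant \<open>C\<close> on any interval by one
that only depends on the germ there (\<open>germ_local_bound\<close>).

Paths are measured on increments over lengths at most \<open>h\<close>, with the exponential weight \<open>exp (t / h)\<close>.
In this scale one estimate, \<open>weighted_holder_step\<close>, says that a bound \<open>N\<close> on a path or on a difference of
paths gives the bound \<open>(N + b) / 2\<close> on the integrals, where \<open>b\<close> collects the data. Absorbing \<open>N\<close> gives
everything: applied to a solution, for which \<open>\<sigma>\<close> grows at most linearly, it gives an a priori bound;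
applied to the difference of two solutions it gives the Lipschitz estimate and, for equal data,
uniqueness; applied to Picard iterates it gives existence.

For differences, the increments of \<open>\<sigma>(t, w, x) - \<sigma>(t, w', x')\<close> have to be bounded linearly in
\<open>x - x'\<close> and \<open>w - w'\<close>, which follows from the mean value inequality since the derivatives are Lipschitz
in space and \<open>\<alpha>\<close>-Hoelder in time. The derivative in \<open>w\<close> is required for the part in which \<open>w\<close>
changes; for \<open>w = w'\<close> the derivative in \<open>x\<close> suffices.
\<close>

section \<open>Additive functions close to a germ\<close>

text \<open>Absorption: iterating \<open>c \<mapsto> r * c + b\<close> from any admissible constant converges to its fixed point.
Used in place of choosing a least admissible constant, it turns "a bound with constant \<open>c\<close> implies a
bound with constant \<open>r * c + b\<close>" into an explicit bound as soon as some bound is known.\<close>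

lemma limit_of_absorption:
  fixes P :: "real \<Rightarrow> bool"
  assumes "P c" and step: "\<And>c. P c \<Longrightarrow> P (r * c + b)"
    and closed: "\<And>c X. X \<longlonglongrightarrow> c \<Longrightarrow> (\<And>n. P (X n)) \<Longrightarrow> P c"
    and r: "0 \<le> r" "r < 1"
  shows "P (b / (1 - r))"
proof -
  define d where "d = b / (1 - r)"
  have "(1 - r) * d = b" using r by (simp add: d_def)
  then have b: "b = d - r * d" by (simp add: algebra_simps)
  have "P (d + r ^ n * (c - d))" for n
  proof (induction n)
    case 0
    then show ?case using \<open>P c\<close> by simp
  next
    case (Suc n)
    have "r * (d + r ^ n * (c - d)) + b = d + r ^ Suc n * (c - d)"
      by (simp add: b algebra_simps)
    then show ?case using step[OF Suc] by simp
  qed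
  moreover have "(\<lambda>n. d + r ^ n * (c - d)) \<longlonglongrightarrow> d + 0 * (c - d)"
    using r by (intro tendsto_intros LIMSEQ_power_zero) auto
  ultimately show ?thesis using closed[of "\<lambda>n. d + r ^ n * (c - d)" d] by (simp add: d_def)
qed

text \<open>Remove the cell that straddles the midpoint of the interval. The points left and right of it fill at
most half of the length each, so the induction hypothesis costs \<open>2 * 2 powr (- \<theta>) < 1\<close> times the
claimed bound, and re-inserting the cell costs two defects \<open>A * (p j - p i) powr \<theta>\<close>; the constant
is the fixed point of this recursion. It depends neither on the number nor on the shape of the cells.\<close>

lemma partition_sum_close_to_germ:
  fixes \<Xi> :: "real \<Rightarrow> real \<Rightarrow> 'e::real_normed_vector" and p :: "nat \<Rightarrow> real"
  assumes \<theta>: "1 < \<theta>"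
    and \<delta>: "\<And>s u t. a \<le> s \<Longrightarrow> s \<le> u \<Longrightarrow> u \<le> t \<Longrightarrow> t \<le> b \<Longrightarrow>
             norm (\<Xi> s t - \<Xi> s u - \<Xi> u t) \<le> A * (t - s) powr \<theta>"
    and p: "mono p" "\<And>k. a \<le> p k" "\<And>k. p k \<le> b"
    and "0 \<le> A" "i \<le> j"
  shows "norm ((\<Sum>k=i..<j. \<Xi> (p k) (p (Suc k))) - \<Xi> (p i) (p j))
           \<le> 2 * A / (1 - 2 powr (1 - \<theta>)) * (p j - p i) powr \<theta>"
  using \<open>i \<le> j\<close>
proof (induction "j - i" arbitrary: i j rule: less_induct)
  case less
  define K where "K = 2 * A / (1 - 2 powr (1 - \<theta>))"
  have r: "2 powr (1 - \<theta>) < 1" using \<theta> powr_less_mono[of "1 - \<theta>" 0 2] by simp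
  have K: "0 \<le> K" using r \<open>0 \<le> A\<close> by (simp add: K_def)
  have "(1 - 2 powr (1 - \<theta>)) * K = 2 * A" using r \<theta> by (simp add: K_def)
  then have K_eq: "2 powr (1 - \<theta>) * K + 2 * A = K" by (simp add: algebra_simps)
  have diag: "\<Xi> s s = 0" if "a \<le> s" "s \<le> b" for s
    using \<delta>[of s s s] that by simp
  show ?case
  proof (cases "i = j")
    case True
    then show ?thesis using diag p(2,3) by simp
  next
    case False
    with less.prems have "i < j" by simp
    define m where "m = (p i + p j) / 2"
    have pij: "p i \<le> p j" using p(1) less.prems by (simp add: monoD)
    define k where "k = Max {k \<in> {i..<j}. p k \<le> m}"
    have "k \<in> {k \<in> {i..<j}. p k \<le> m}"
      unfolding k_def by (rule Max_in) (use \<open>i < j\<close> pij in \<open>auto simp: m_def\<close>)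
    then have k: "i \<le> k" "k < j" "p k \<le> m" by auto
    have mk: "m \<le> p (Suc k)"
    proof (cases "Suc k = j")
      case True
      then show ?thesis using pij by (simp add: m_def)
    next
      case False
      show ?thesis
      proof (rule ccontr)
        assume "\<not> m \<le> p (Suc k)"
        then have "Suc k \<in> {k \<in> {i..<j}. p k \<le> m}" using k False by auto
        then have "Suc k \<le> k" unfolding k_def by (intro Max_ge) auto
        then show False by simp
      qed
    qed
    have mon: "p i \<le> p k" "p k \<le> p (Suc k)" "p (Suc k) \<le> p j"
      using k by (simp_all add: monoD[OF p(1)])
    define d where "d = p j - p i"
    have half: "K * x powr \<theta> \<le> K * (d powr \<theta> * 2 powr (- \<theta>))" if "0 \<le> x" "x \<le> d / 2" for x
    proof -
      have "x powr \<theta> \<le> (d / 2) powr \<theta>" using that \<theta> by (intro powr_mono2) auto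
      also have "\<dots> = d powr \<theta> * 2 powr (- \<theta>)"
        using pij by (simp add: d_def powr_divide powr_minus field_simps)
      finally show ?thesis using K by (rule mult_left_mono)
    qed
    have L: "norm ((\<Sum>k=i..<k. \<Xi> (p k) (p (Suc k))) - \<Xi> (p i) (p k)) \<le> K * (d powr \<theta> * 2 powr (- \<theta>))"
      using less.hyps[of k i, folded K_def] k mon pij
      by (intro order.trans[OF _ half[of "p k - p i"]]) (auto simp: m_def d_def field_simps)
    have R: "norm ((\<Sum>k=Suc k..<j. \<Xi> (p k) (p (Suc k))) - \<Xi> (p (Suc k)) (p j)) \<le> K * (d powr \<theta> * 2 powr (- \<theta>))"
      using less.hyps[of j "Suc k", folded K_def] k mon mk pij
      by (intro order.trans[OF _ half[of "p j - p (Suc k)"]]) (auto simp: m_def d_def field_simps)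
    have e1: "norm (\<Xi> (p i) (p j) - \<Xi> (p i) (p k) - \<Xi> (p k) (p j)) \<le> A * d powr \<theta>"
      using \<delta>[of "p i" "p k" "p j"] mon p(2,3) by (auto simp: d_def)
    have "norm (\<Xi> (p k) (p j) - \<Xi> (p k) (p (Suc k)) - \<Xi> (p (Suc k)) (p j)) \<le> A * (p j - p k) powr \<theta>"
      using \<delta>[of "p k" "p (Suc k)" "p j"] mon p(2,3) by auto
    also have "\<dots> \<le> A * d powr \<theta>"
      using mon \<open>0 \<le> A\<close> \<theta> by (intro mult_left_mono powr_mono2) (auto simp: d_def)
    finally have e2: "norm (\<Xi> (p k) (p j) - \<Xi> (p k) (p (Suc k)) - \<Xi> (p (Suc k)) (p j)) \<le> A * d powr \<theta>" .
    have split: "(\<Sum>k=i..<j. \<Xi> (p k) (p (Suc k))) =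
      (\<Sum>k=i..<k. \<Xi> (p k) (p (Suc k))) + (\<Xi> (p k) (p (Suc k)) + (\<Sum>k=Suc k..<j. \<Xi> (p k) (p (Suc k))))"
      using k by (subst sum.atLeastLessThan_concat[of i k j, symmetric])
        (simp_all add: sum.atLeast_Suc_lessThan[of k j])
    have "(\<Sum>k=i..<j. \<Xi> (p k) (p (Suc k))) - \<Xi> (p i) (p j) =
        ((\<Sum>k=i..<k. \<Xi> (p k) (p (Suc k))) - \<Xi> (p i) (p k))
      + ((\<Sum>k=Suc k..<j. \<Xi> (p k) (p (Suc k))) - \<Xi> (p (Suc k)) (p j))
      + - (\<Xi> (p i) (p j) - \<Xi> (p i) (p k) - \<Xi> (p k) (p j))
      + - (\<Xi> (p k) (p j) - \<Xi> (p k) (p (Suc k)) - \<Xi> (p (Suc k)) (p j))"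
      unfolding split by (simp add: algebra_simps)
    also have "norm \<dots> \<le> K * (d powr \<theta> * 2 powr (- \<theta>)) + K * (d powr \<theta> * 2 powr (- \<theta>))
        + A * d powr \<theta> + A * d powr \<theta>"
      by (intro norm_triangle_mono L R) (use e1 e2 in \<open>simp_all only: norm_minus_cancel\<close>)
    also have "\<dots> = (2 powr (1 - \<theta>) * K + 2 * A) * d powr \<theta>"
      by (simp add: algebra_simps powr_diff powr_minus field_simps)
    also have "\<dots> = K * d powr \<theta>" by (simp only: K_eq)
    finally show ?thesis by (simp add: K_def d_def)
  qed
qed

locale young_exponents =
  fixes T \<alpha> \<beta> :: real
  assumes T_pos: "0 < T" and \<alpha>_half: "1 / 2 < \<alpha>" and \<alpha>_less_\<beta>: "\<alpha> < \<beta>"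
begin

abbreviation \<theta> :: real where "\<theta> \<equiv> \<alpha> + \<beta>"

text \<open>The constant of the local sewing estimate: the sum of the geometric series with ratio
\<open>2 * 2 powr (- \<theta>)\<close>, in which each bisection of an interval contributes one term.\<close>

definition \<kappa> :: real where "\<kappa> = 1 / (1 - 2 powr (1 - \<theta>))"

text \<open>Davie's local description of an indefinite integral: the increments of \<open>y\<close> agree with the germ \<open>\<Xi>\<close>
up to an error of order \<open>\<theta> > 1\<close>. Two such \<open>y\<close> differ by a constant. The relation is linear
in the pair of germ and function, and closed under pointwise limits at fixed \<open>C\<close>.\<close>

definition follows_germ :: "real \<Rightarrow> (real \<Rightarrow> real \<Rightarrow> 'e::real_normed_vector) \<Rightarrow> (real \<Rightarrow> 'e) \<Rightarrow> bool" where
  "follows_germ C \<Xi> y \<longleftrightarrow>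
     (\<forall>s t. 0 \<le> s \<longrightarrow> s \<le> t \<longrightarrow> t \<le> T \<longrightarrow> norm (y t - y s - \<Xi> s t) \<le> C * (t - s) powr \<theta>)"

lemma follows_germD:
  "follows_germ C \<Xi> y \<Longrightarrow> 0 \<le> s \<Longrightarrow> s \<le> t \<Longrightarrow> t \<le> T \<Longrightarrow> norm (y t - y s - \<Xi> s t) \<le> C * (t - s) powr \<theta>"
  by (simp add: follows_germ_def)

lemma \<theta>_gt_1: "1 < \<theta>" using \<alpha>_half \<alpha>_less_\<beta> by simp

lemma half_ratio: "2 powr (1 - \<theta>) < 1"
  using \<theta>_gt_1 powr_less_mono[of "1 - \<theta>" 0 2] by simp

lemma \<kappa>_pos: "0 < \<kappa>" using half_ratio by (simp add: \<kappa>_def)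

text \<open>The constant \<open>C\<close> of the hypothesis does not enter the conclusion: bisecting an interval improves
any constant \<open>c\<close> to \<open>2 powr (1 - \<theta>) * c + A\<close>. The germ is inspected only inside \<open>{a..b}\<close>,
which makes estimates on short intervals possible.\<close>

lemma germ_local_bound:
  fixes y :: "real \<Rightarrow> 'e::real_normed_vector"
  assumes y: "follows_germ C \<Xi> y" and ab: "0 \<le> a" "a \<le> b" "b \<le> T"
    and \<delta>: "\<And>s u t. a \<le> s \<Longrightarrow> s \<le> u \<Longrightarrow> u \<le> t \<Longrightarrow> t \<le> b \<Longrightarrow>
             norm (\<Xi> s t - \<Xi> s u - \<Xi> u t) \<le> A * (t - s) powr \<theta>"
  shows "norm (y b - y a - \<Xi> a b) \<le> \<kappa> * A * (b - a) powr \<theta>"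
proof -
  define P where "P c \<longleftrightarrow> (\<forall>s t. a \<le> s \<longrightarrow> s \<le> t \<longrightarrow> t \<le> b \<longrightarrow>
      norm (y t - y s - \<Xi> s t) \<le> c * (t - s) powr \<theta>)" for c
  have "P (A / (1 - 2 powr (1 - \<theta>)))"
  proof (rule limit_of_absorption)
    show "P C" using y ab by (auto simp: P_def follows_germ_def)
    show "P (2 powr (1 - \<theta>) * c + A)" if c: "P c" for c
      unfolding P_def
    proof (intro allI impI)
      fix s t assume st: "a \<le> s" "s \<le> t" "t \<le> b"
      define u where "u = (s + t) / 2"
      have half: "((t - s) / 2) powr \<theta> = (t - s) powr \<theta> * 2 powr (- \<theta>)"
        using st by (simp add: powr_divide powr_minus_divide del: minus_add_distrib)
      have 1: "norm (y u - y s - \<Xi> s u) \<le> c * ((t - s) / 2) powr \<theta>"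
        using c[unfolded P_def, rule_format, of s u] st by (simp add: u_def field_simps)
      have 2: "norm (y t - y u - \<Xi> u t) \<le> c * ((t - s) / 2) powr \<theta>"
        using c[unfolded P_def, rule_format, of u t] st by (simp add: u_def field_simps)
      have 3: "norm (\<Xi> s t - \<Xi> s u - \<Xi> u t) \<le> A * (t - s) powr \<theta>"
        using \<delta>[of s u t] st by (simp add: u_def)
      have "y t - y s - \<Xi> s t = (y u - y s - \<Xi> s u) + (y t - y u - \<Xi> u t) - (\<Xi> s t - \<Xi> s u - \<Xi> u t)"
        by simp
      also have "norm \<dots> \<le> c * ((t - s) / 2) powr \<theta> + c * ((t - s) / 2) powr \<theta> + A * (t - s) powr \<theta>"
        by (rule order.trans[OF norm_triangle_ineq4], rule add_mono,
            rule order.trans[OF norm_triangle_ineq], rule add_mono) (fact 1 2 3)+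
      also have "\<dots> = (2 powr (1 - \<theta>) * c + A) * (t - s) powr \<theta>"
        unfolding half by (simp add: algebra_simps powr_diff powr_minus field_simps powr_add)
      finally show "norm (y t - y s - \<Xi> s t) \<le> (2 powr (1 - \<theta>) * c + A) * (t - s) powr \<theta>" .
    qed
    show "P c" if "X \<longlonglongrightarrow> c" "\<And>n. P (X n)" for X c
      unfolding P_def
    proof (intro allI impI)
      fix s t assume st: "a \<le> s" "s \<le> t" "t \<le> b"
      have "(\<lambda>n. X n * (t - s) powr \<theta>) \<longlonglongrightarrow> c * (t - s) powr \<theta>"
        using that by (intro tendsto_intros)
      then show "norm (y t - y s - \<Xi> s t) \<le> c * (t - s) powr \<theta>"
        by (rule LIMSEQ_le_const) (use that(2) st in \<open>auto simp: P_def\<close>)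
    qed
  qed (use half_ratio in auto)
  then show ?thesis using ab by (simp add: P_def \<kappa>_def)
qed

text \<open>Sums of \<open>\<Xi>\<close> over the dyadic grids of the whole interval, cut off at \<open>t\<close>, converge
geometrically. Cutting one fixed grid at \<open>t\<close> makes the increment from \<open>s\<close> to \<open>t\<close> equal to the sum
over the grid restricted to \<open>{s..t}\<close>, except for the single cell that contains \<open>s\<close>, whose defect
disappears in the limit; on the restricted grid the previous estimate for partition sums applies.\<close>

lemma sewing:
  fixes \<Xi> :: "real \<Rightarrow> real \<Rightarrow> 'e::banach"
  assumes "0 \<le> A"
    and \<delta>: "\<And>s u t. 0 \<le> s \<Longrightarrow> s \<le> u \<Longrightarrow> u \<le> t \<Longrightarrow> t \<le> T \<Longrightarrow>
             norm (\<Xi> s t - \<Xi> s u - \<Xi> u t) \<le> A * (t - s) powr \<theta>"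
  shows "\<exists>y C. y 0 = 0 \<and> follows_germ C \<Xi> y"
proof -
  define p where "p n k = T * real k / 2 ^ n" for n k
  have p_mono: "p n k \<le> p n l" if "k \<le> l" for n k l
    using that T_pos by (auto simp: p_def intro!: divide_right_mono mult_left_mono)
  have p_step: "p n (Suc k) = p n k + T / 2 ^ n" for n k
    by (simp add: p_def field_simps)
  have p_0: "p n 0 = 0" and p_T: "p n (2 ^ n) = T" and p_nn: "0 \<le> p n k" for n k
    using T_pos by (auto simp: p_def)
  have diag: "\<Xi> s s = 0" if "0 \<le> s" "s \<le> T" for s
    using \<delta>[of s s s] that by simp
  define J where "J n t = (\<Sum>k<2^n. \<Xi> (min t (p n k)) (min t (p n (Suc k))))" for n t
  have refine: "norm (J (Suc n) t - J n t) \<le> A * T powr \<theta> * (2 powr (1 - \<theta>)) ^ n"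
    if t: "0 \<le> t" "t \<le> T" for n t
  proof -
    have p2: "p (Suc n) (k * 2) = p n k" for k by (simp add: p_def)
    have p2': "p (Suc n) (Suc (Suc (k * 2))) = p n (Suc k)" for k
      using p2[of "Suc k"] by simp
    define \<Delta> where "\<Delta> k = min t (p n (Suc k)) - min t (p n k)" for k
    have \<Delta>: "0 \<le> \<Delta> k" "\<Delta> k \<le> T / 2 ^ n" for k
      using p_mono[of k "Suc k" n] p_step[of n k] by (auto simp: \<Delta>_def)
    have "J (Suc n) t = (\<Sum>k<2^n. sum (\<lambda>k. \<Xi> (min t (p (Suc n) k)) (min t (p (Suc n) (Suc k)))) {k*2..<k*2+2})"
      unfolding J_def sum.nat_group by (simp add: mult.commute)
    also have "\<dots> = (\<Sum>k<2^n. \<Xi> (min t (p n k)) (min t (p (Suc n) (Suc (k*2))))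
        + \<Xi> (min t (p (Suc n) (Suc (k*2)))) (min t (p n (Suc k))))"
      by (intro sum.cong) (simp_all add: p2 p2')
    finally have diff: "J (Suc n) t - J n t = (\<Sum>k<2^n. - (\<Xi> (min t (p n k)) (min t (p n (Suc k)))
        - \<Xi> (min t (p n k)) (min t (p (Suc n) (Suc (k*2))))
        - \<Xi> (min t (p (Suc n) (Suc (k*2)))) (min t (p n (Suc k)))))"
      unfolding J_def by (simp add: sum_subtractf[symmetric] algebra_simps)
    have "norm (J (Suc n) t - J n t) \<le> (\<Sum>k<2^n. A * (T / 2 ^ n) powr (\<theta> - 1) * \<Delta> k)"
      unfolding diff
    proof (rule order.trans[OF norm_sum], rule sum_mono)
      fix k
      have o: "p n k \<le> p (Suc n) (Suc (k*2))" "p (Suc n) (Suc (k*2)) \<le> p n (Suc k)"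
        using p_mono[of "k*2" "Suc (k*2)" "Suc n"] p_mono[of "Suc (k*2)" "Suc (Suc (k*2))" "Suc n"]
        by (auto simp: p2 p2')
      have 1: "norm (\<Xi> (min t (p n k)) (min t (p n (Suc k)))
        - \<Xi> (min t (p n k)) (min t (p (Suc n) (Suc (k*2))))
        - \<Xi> (min t (p (Suc n) (Suc (k*2)))) (min t (p n (Suc k)))) \<le> A * \<Delta> k powr \<theta>"
        unfolding \<Delta>_def using o t p_nn by (intro \<delta>) auto
      have 2: "\<Delta> k powr \<theta> = \<Delta> k powr (\<theta> - 1) * \<Delta> k"
        using \<Delta>[of k] by (cases "\<Delta> k = 0") (auto simp: powr_diff)
      have 3: "A * (\<Delta> k powr (\<theta> - 1) * \<Delta> k) \<le> A * ((T / 2 ^ n) powr (\<theta> - 1) * \<Delta> k)"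
        using \<Delta>[of k] \<theta>_gt_1 \<open>0 \<le> A\<close> by (intro mult_left_mono mult_right_mono powr_mono2) auto
      show "norm (- (\<Xi> (min t (p n k)) (min t (p n (Suc k)))
        - \<Xi> (min t (p n k)) (min t (p (Suc n) (Suc (k*2))))
        - \<Xi> (min t (p (Suc n) (Suc (k*2)))) (min t (p n (Suc k))))) \<le> A * (T / 2 ^ n) powr (\<theta> - 1) * \<Delta> k"
        using 1 3 by (simp only: norm_minus_cancel mult.assoc 2)
    qed
    also have "\<dots> = A * (T / 2 ^ n) powr (\<theta> - 1) * t"
    proof -
      have "(\<Sum>k<2^n. \<Delta> k) = min t (p n (2^n)) - min t (p n 0)"
        unfolding \<Delta>_def by (rule sum_lessThan_telescope)
      then show ?thesis using t p_T p_0 by (simp add: sum_distrib_left[symmetric])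
    qed
    also have "\<dots> \<le> A * (T / 2 ^ n) powr (\<theta> - 1) * T"
      using t \<open>0 \<le> A\<close> by (intro mult_left_mono) auto
    also have "\<dots> = A * T powr \<theta> * (2 powr (1 - \<theta>)) ^ n"
    proof -
      have "(2 ^ n) powr (\<theta> - 1) = inverse ((2 powr (1 - \<theta>)) ^ n)"
        by (simp add: powr_realpow[symmetric] powr_powr powr_minus[symmetric] algebra_simps)
      moreover have "T powr (\<theta> - 1) * T = T powr \<theta>" using T_pos by (simp add: powr_diff)
      ultimately show ?thesis using T_pos by (simp add: powr_divide field_simps)
    qed
    finally show ?thesis .
  qed
  have "convergent (\<lambda>n. J n t)" if t: "0 \<le> t" "t \<le> T" for t
  proof -
    have "summable (\<lambda>n. A * T powr \<theta> * (2 powr (1 - \<theta>)) ^ n)"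
      using half_ratio by (intro summable_mult summable_geometric) simp
    then have "summable (\<lambda>n. J (Suc n) t - J n t)"
      by (rule summable_comparison_test'[where N = 0]) (use refine[OF t] in blast)
    then have "convergent (\<lambda>m. J m t - J 0 t)"
      by (simp add: summable_iff_convergent sum_lessThan_telescope[where f = "\<lambda>n. J n t"])
    then have "convergent (\<lambda>m. J m t - J 0 t + J 0 t)"
      by (intro convergent_add convergent_const)
    then show ?thesis by simp
  qed
  then have lim: "(\<lambda>n. J n t) \<longlonglongrightarrow> lim (\<lambda>n. J n t)" if "0 \<le> t" "t \<le> T" for t
    using that by (simp add: convergent_LIMSEQ_iff)
  define K where "K = 2 * A / (1 - 2 powr (1 - \<theta>))"
  have close: "norm (J n t - J n s - \<Xi> s t) \<le> A * (T / 2 ^ n) powr \<theta> + K * (t - s) powr \<theta>"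
    if st: "0 \<le> s" "s \<le> t" "t \<le> T" for n s t
  proof -
    define q where "q k = max s (min t (p n k))" for k
    \<comment> \<open>\<open>G\<close> is the failure of additivity at \<open>s\<close> of the cell \<open>k\<close>; it is supported on the cell around \<open>s\<close>.\<close>
    define G where "G k = \<Xi> (min t (p n k)) (min t (p n (Suc k)))
        - \<Xi> (min s (p n k)) (min s (p n (Suc k))) - \<Xi> (q k) (q (Suc k))" for k
    have q: "norm ((\<Sum>k=0..<2^n. \<Xi> (q k) (q (Suc k))) - \<Xi> (q 0) (q (2^n))) \<le> K * (q (2^n) - q 0) powr \<theta>"
      unfolding K_def
    proof (rule partition_sum_close_to_germ[where a = 0 and b = T])
      show "mono q" unfolding q_def
        by (intro monoI) (auto simp: min_def max_def dest: p_mono[of _ _ n])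
    qed (use st \<theta>_gt_1 \<delta> \<open>0 \<le> A\<close> in \<open>auto simp: q_def\<close>)
    have q0: "q 0 = s" "q (2^n) = t" using st by (auto simp: q_def p_0 p_T)
    have G0: "G k = 0" if "\<not> (p n k < s \<and> s < p n (Suc k))" for k
    proof (cases "s \<le> p n k")
      case True
      then show ?thesis using p_mono[of k "Suc k" n] st diag[of s] by (auto simp: G_def q_def min_def max_def)
    next
      case False
      with that have "p n k \<le> s" "p n (Suc k) \<le> s" by auto
      then have "min t (p n k) = p n k" "min s (p n k) = p n k" "q k = s"
        "min t (p n (Suc k)) = p n (Suc k)" "min s (p n (Suc k)) = p n (Suc k)" "q (Suc k) = s"
        using st by (auto simp: q_def)
      then show ?thesis using diag[of s] st by (simp add: G_def)
    qed
    have uniq: "k = l" if "p n k < s \<and> s < p n (Suc k)" "p n l < s \<and> s < p n (Suc l)" for k l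
    proof (rule ccontr)
      assume "k \<noteq> l"
      then have "Suc k \<le> l \<or> Suc l \<le> k" by auto
      then show False using p_mono[of "Suc k" l n] p_mono[of "Suc l" k n] that by auto
    qed
    have G1: "norm (G k) \<le> A * (T / 2 ^ n) powr \<theta>" if k: "p n k < s \<and> s < p n (Suc k)" for k
    proof -
      have "G k = \<Xi> (p n k) (min t (p n (Suc k))) - \<Xi> (p n k) s - \<Xi> s (min t (p n (Suc k)))"
        using k st by (auto simp: G_def q_def min_def max_def)
      also have "norm \<dots> \<le> A * (min t (p n (Suc k)) - p n k) powr \<theta>"
        using k st p_nn by (intro \<delta>) auto
      also have "\<dots> \<le> A * (T / 2 ^ n) powr \<theta>"
        using k st p_step[of n k] \<theta>_gt_1 \<open>0 \<le> A\<close> by (intro mult_left_mono powr_mono2) auto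
      finally show ?thesis .
    qed
    have G: "norm (\<Sum>k<2^n. G k) \<le> A * (T / 2 ^ n) powr \<theta>"
    proof (cases "\<exists>k<2^n. p n k < s \<and> s < p n (Suc k)")
      case True
      then obtain k where k: "k < 2^n" "p n k < s \<and> s < p n (Suc k)" by auto
      have "(\<Sum>k<2^n. G k) = (\<Sum>k\<in>{k}. G k)"
        using k uniq G0 by (intro sum.mono_neutral_right) auto
      then show ?thesis using G1 k by simp
    next
      case False
      then have "(\<Sum>k<2^n. G k) = 0" using G0 by (intro sum.neutral) auto
      then show ?thesis using \<open>0 \<le> A\<close> by simp
    qed
    have "J n t - J n s - \<Xi> s t = (\<Sum>k<2^n. G k) + ((\<Sum>k=0..<2^n. \<Xi> (q k) (q (Suc k))) - \<Xi> (q 0) (q (2^n)))"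
      by (simp add: J_def G_def sum_subtractf q0 atLeast0LessThan)
    also have "norm \<dots> \<le> A * (T / 2 ^ n) powr \<theta> + K * (t - s) powr \<theta>"
      using norm_triangle_mono[OF G q] by (simp add: q0)
    finally show ?thesis .
  qed
  have "follows_germ K \<Xi> (\<lambda>t. lim (\<lambda>n. J n t))"
    unfolding follows_germ_def
  proof (intro allI impI)
    fix s t assume st: "0 \<le> s" "s \<le> t" "t \<le> T"
    have "(\<lambda>n. T / 2 ^ n) \<longlonglongrightarrow> 0"
      using tendsto_mult_right_zero[OF LIMSEQ_power_zero[of "1/2::real"], of T]
      by (simp add: field_simps power_divide)
    then have "(\<lambda>n. (T / 2 ^ n) powr \<theta>) \<longlonglongrightarrow> 0 powr \<theta>"
      by (rule tendsto_powr') (use \<theta>_gt_1 T_pos in auto)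
    then have "(\<lambda>n. A * (T / 2 ^ n) powr \<theta> + K * (t - s) powr \<theta>) \<longlonglongrightarrow> A * 0 powr \<theta> + K * (t - s) powr \<theta>"
      by (intro tendsto_add tendsto_mult tendsto_const)
    moreover have "(\<lambda>n. norm (J n t - J n s - \<Xi> s t)) \<longlonglongrightarrow> norm (lim (\<lambda>n. J n t) - lim (\<lambda>n. J n s) - \<Xi> s t)"
      using st by (intro tendsto_intros lim) auto
    ultimately have "norm (lim (\<lambda>n. J n t) - lim (\<lambda>n. J n s) - \<Xi> s t) \<le> A * 0 powr \<theta> + K * (t - s) powr \<theta>"
      using close[OF st] by (intro LIMSEQ_le) auto
    then show "norm (lim (\<lambda>n. J n t) - lim (\<lambda>n. J n s) - \<Xi> s t) \<le> K * (t - s) powr \<theta>" by simp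
  qed
  moreover have "J n 0 = 0" for n
    unfolding J_def using p_nn T_pos diag[of 0] by (simp add: min_def p_nn)
  ultimately show ?thesis by (intro exI[of _ "\<lambda>t. lim (\<lambda>n. J n t)"]) auto
qed

end

section \<open>Young integrals as limits of Riemann sums\<close>

text \<open>Arbitrarily fine divisions exist (Cousin's lemma, here from the existence of fine tagged divisions).\<close>

lemma has_young_integral_unique:
  assumes I: "has_young_integral f g a b I" and J: "has_young_integral f g a b J"
  shows "I = J"
proof (rule ccontr)
  assume "I \<noteq> J"
  define \<epsilon> where "\<epsilon> = norm (I - J) / 2"
  have "0 < \<epsilon>" using \<open>I \<noteq> J\<close> by (simp add: \<epsilon>_def)
  define S where "S \<pi> = (\<Sum>K\<in>\<pi>. blinfun_apply (f (Inf K)) (g (Sup K) - g (Inf K)))" for \<pi>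
  obtain d where "0 < d" and d: "\<forall>\<pi>. \<pi> division_of {a..b} \<and> (\<forall>K\<in>\<pi>. Sup K - Inf K < d) \<longrightarrow> norm (S \<pi> - I) < \<epsilon>"
    using I[unfolded has_young_integral_def, rule_format, OF \<open>0 < \<epsilon>\<close>] unfolding S_def by (elim exE conjE)
  obtain e where "0 < e" and e: "\<forall>\<pi>. \<pi> division_of {a..b} \<and> (\<forall>K\<in>\<pi>. Sup K - Inf K < e) \<longrightarrow> norm (S \<pi> - J) < \<epsilon>"
    using J[unfolded has_young_integral_def, rule_format, OF \<open>0 < \<epsilon>\<close>] unfolding S_def by (elim exE conjE)
  define \<delta> where "\<delta> = min d e"
  have "0 < \<delta>" using \<open>0 < d\<close> \<open>0 < e\<close> by (simp add: \<delta>_def)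
  then have "gauge (\<lambda>x::real. ball x (\<delta> / 2))" by (intro gauge_ball) simp
  then obtain p where p: "p tagged_division_of {a..b}" "(\<lambda>x. ball x (\<delta> / 2)) fine p"
    by (rule fine_division_exists_real)
  have \<pi>: "snd ` p division_of {a..b}" using p(1) by (rule division_of_tagged_division)
  have mesh: "Sup K - Inf K < \<delta>" if K: "K \<in> snd ` p" for K
  proof -
    obtain x where x: "(x, K) \<in> p" using K by force
    obtain u v where uv: "K = {u..v}" "K \<noteq> {}"
      using tagged_division_ofD(4)[OF p(1) x] tagged_division_ofD(2)[OF p(1) x] by auto
    have "K \<subseteq> ball x (\<delta> / 2)" using fineD[OF p(2) x] .
    moreover have "u \<in> K" "v \<in> K" "u \<le> v" using uv by auto
    ultimately have "dist x u < \<delta> / 2" "dist x v < \<delta> / 2" by auto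
    then have "v - u < \<delta>" unfolding dist_real_def by linarith
    then show ?thesis using uv \<open>u \<le> v\<close> by simp
  qed
  have "norm (S (snd ` p) - I) < \<epsilon>" "norm (S (snd ` p) - J) < \<epsilon>"
    using \<pi> mesh by (auto intro!: d[rule_format] e[rule_format] simp: \<delta>_def)
  moreover have "norm (I - J) \<le> norm (S (snd ` p) - J) + norm (S (snd ` p) - I)"
    using norm_triangle_ineq4[of "S (snd ` p) - J" "S (snd ` p) - I"] by simp
  ultimately show False by (simp add: \<epsilon>_def)
qed

lemma sum_division_telescope:
  fixes h :: "real \<Rightarrow> 'e::real_normed_vector"
  assumes "\<pi> division_of {a..b}" "a \<le> b"
  shows "(\<Sum>K\<in>\<pi>. h (Sup K) - h (Inf K)) = h b - h a"
proof -
  have ne: "Inf K \<in> K" if "K \<in> \<pi>" for K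
    using division_ofD(3,4)[OF assms(1) that] by auto
  then have inj: "inj_on (\<lambda>K. (Inf K, K)) \<pi>" by (auto simp: inj_on_def)
  have "(\<lambda>K. (Inf K, K)) ` \<pi> tagged_division_of {a..b}"
  proof (rule tagged_division_ofI)
    show "finite ((\<lambda>K. (Inf K, K)) ` \<pi>)" using division_ofD(1)[OF assms(1)] by simp
    show "\<Union>{K. \<exists>x. (x, K) \<in> (\<lambda>K. (Inf K, K)) ` \<pi>} = {a..b}"
      using division_ofD(6)[OF assms(1)] by (simp add: image_iff)
    show "x \<in> K" "K \<subseteq> {a..b}" "\<exists>a b. K = cbox a b" if "(x, K) \<in> (\<lambda>K. (Inf K, K)) ` \<pi>" for x K
      using that division_ofD(2,4)[OF assms(1), of K] ne by auto
    show "interior K1 \<inter> interior K2 = {}"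
      if "(x1, K1) \<in> (\<lambda>K. (Inf K, K)) ` \<pi>" "(x2, K2) \<in> (\<lambda>K. (Inf K, K)) ` \<pi>" "(x1, K1) \<noteq> (x2, K2)"
      for x1 K1 x2 K2
      using that division_ofD(5)[OF assms(1), of K1 K2] by auto
  qed
  then have "(\<Sum>(x,K)\<in>(\<lambda>K. (Inf K, K)) ` \<pi>. h (Sup K) - h (Inf K)) = h b - h a"
    by (rule additive_tagged_division_1[OF assms(2)])
  then show ?thesis by (simp add: sum.reindex[OF inj])
qed

context young_exponents
begin

text \<open>The increments of \<open>y\<close> telescope over a division, so the Riemann sum misses \<open>y t - y 0\<close> by at most the
sum of \<open>C * (v - u) powr \<theta>\<close> over its intervals, which the mesh to the power \<open>\<theta> - 1 > 0\<close> controls.\<close>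

lemma follows_germ_has_young_integral:
  assumes y: "follows_germ C (\<lambda>s t. blinfun_apply (f s) (g t - g s)) y"
    and t: "0 \<le> t" "t \<le> T"
  shows "has_young_integral f g 0 t (y t - y 0)"
  unfolding has_young_integral_def
proof (intro allI impI)
  fix \<epsilon> :: real assume "0 < \<epsilon>"
  define C' where "C' = \<bar>C\<bar> + 1"
  have "0 < C'" by (simp add: C'_def)
  \<comment> \<open>The mesh is chosen so that the total error bound \<open>C' * \<delta> powr (\<theta> - 1) * T\<close> is \<open>\<epsilon> / 2\<close>.\<close>
  define \<delta> where "\<delta> = (\<epsilon> / (2 * C' * T)) powr (1 / (\<theta> - 1))"
  have "0 < \<delta>" using \<open>0 < \<epsilon>\<close> \<open>0 < C'\<close> T_pos by (simp add: \<delta>_def)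
  have \<delta>: "C' * \<delta> powr (\<theta> - 1) * T = \<epsilon> / 2"
    using \<open>0 < \<epsilon>\<close> \<open>0 < C'\<close> T_pos \<theta>_gt_1 by (simp add: \<delta>_def powr_powr)
  have "norm ((\<Sum>K\<in>\<pi>. blinfun_apply (f (Inf K)) (g (Sup K) - g (Inf K))) - (y t - y 0)) < \<epsilon>"
    if \<pi>: "\<pi> division_of {0..t}" and mesh: "\<forall>K\<in>\<pi>. Sup K - Inf K < \<delta>" for \<pi>
  proof -
    have "(\<Sum>K\<in>\<pi>. blinfun_apply (f (Inf K)) (g (Sup K) - g (Inf K))) - (y t - y 0)
       = (\<Sum>K\<in>\<pi>. - (y (Sup K) - y (Inf K) - blinfun_apply (f (Inf K)) (g (Sup K) - g (Inf K))))"
      using sum_division_telescope[OF \<pi> t(1), of y] by (simp add: sum_subtractf)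
    also have "norm \<dots> \<le> (\<Sum>K\<in>\<pi>. C' * \<delta> powr (\<theta> - 1) * (Sup K - Inf K))"
    proof (rule order.trans[OF norm_sum], rule sum_mono)
      fix K assume K: "K \<in> \<pi>"
      obtain u v where uv: "K = {u..v}" "u \<le> v" "0 \<le> u" "v \<le> t"
        using division_ofD(2,3,4)[OF \<pi> K] by fastforce
      have "v - u < \<delta>" using mesh K uv by auto
      have 1: "norm (y v - y u - blinfun_apply (f u) (g v - g u)) \<le> C * (v - u) powr \<theta>"
        using follows_germD[OF y, of u v] uv t by simp
      have 2: "C * (v - u) powr \<theta> \<le> C' * (v - u) powr \<theta>"
        by (intro mult_right_mono) (auto simp: C'_def)
      have 3: "(v - u) powr \<theta> = (v - u) powr (\<theta> - 1) * (v - u)"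
        using uv by (cases "v = u") (auto simp: powr_diff)
      have 4: "C' * ((v - u) powr (\<theta> - 1) * (v - u)) \<le> C' * (\<delta> powr (\<theta> - 1) * (v - u))"
        using \<open>v - u < \<delta>\<close> uv \<open>0 < C'\<close> \<theta>_gt_1
        by (intro mult_left_mono mult_right_mono powr_mono2) auto
      show "norm (- (y (Sup K) - y (Inf K) - blinfun_apply (f (Inf K)) (g (Sup K) - g (Inf K))))
         \<le> C' * \<delta> powr (\<theta> - 1) * (Sup K - Inf K)"
        using 1 2 3 4 uv by (simp add: mult.assoc norm_minus_commute)
    qed
    also have "\<dots> = C' * \<delta> powr (\<theta> - 1) * t"
      using sum_division_telescope[OF \<pi> t(1), of "\<lambda>x. x"] by (simp add: sum_distrib_left[symmetric])
    also have "\<dots> \<le> C' * \<delta> powr (\<theta> - 1) * T"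
      using t \<open>0 < C'\<close> by (intro mult_left_mono) auto
    also have "\<dots> < \<epsilon>" using \<delta> \<open>0 < \<epsilon>\<close> by simp
    finally show ?thesis .
  qed
  then show "\<exists>\<delta>>0. \<forall>\<pi>. \<pi> division_of {0..t} \<and> (\<forall>K\<in>\<pi>. Sup K - Inf K < \<delta>) \<longrightarrow>
        norm ((\<Sum>K\<in>\<pi>. blinfun_apply (f (Inf K)) (g (Sup K) - g (Inf K))) - (y t - y 0)) < \<epsilon>"
    using \<open>0 < \<delta>\<close> by blast
qed

text \<open>A single radius bounds both the values and the Hoelder quotients. All estimates are expressed with
explicit bounds of this kind, so that suprema occur only in the translation to \<^const>\<open>holder_norm\<close>.\<close>

definition holder_ball :: "real \<Rightarrow> real \<Rightarrow> (real \<Rightarrow> 'e::real_normed_vector) \<Rightarrow> bool" where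
  "holder_ball \<gamma> R z \<longleftrightarrow> (\<forall>t. 0 \<le> t \<longrightarrow> t \<le> T \<longrightarrow> norm (z t) \<le> R) \<and>
     (\<forall>s t. 0 \<le> s \<longrightarrow> s \<le> t \<longrightarrow> t \<le> T \<longrightarrow> norm (z t - z s) \<le> R * (t - s) powr \<gamma>)"

lemma holder_ball_sup: "holder_ball \<gamma> R z \<Longrightarrow> 0 \<le> t \<Longrightarrow> t \<le> T \<Longrightarrow> norm (z t) \<le> R"
  by (simp add: holder_ball_def)

lemma holder_ball_increment:
  "holder_ball \<gamma> R z \<Longrightarrow> 0 \<le> s \<Longrightarrow> s \<le> t \<Longrightarrow> t \<le> T \<Longrightarrow> norm (z t - z s) \<le> R * (t - s) powr \<gamma>"
  by (simp add: holder_ball_def)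

lemma holder_ball_nonneg: "holder_ball \<gamma> R z \<Longrightarrow> 0 \<le> R"
  using holder_ball_sup[of \<gamma> R z 0] T_pos by (meson less_imp_le norm_ge_zero order.refl order.trans)

lemma holder_ball_mono: "holder_ball \<gamma> R z \<Longrightarrow> R \<le> R' \<Longrightarrow> holder_ball \<gamma> R' z"
  unfolding holder_ball_def by (meson mult_right_mono order.trans powr_ge_zero)

text \<open>The defect of the Young germ is \<open>- (f u - f s) (g t - g u)\<close>, a product of increments of orders \<open>\<alpha>\<close>
and \<open>\<beta>\<close>.\<close>

lemma young_germ_defect:
  assumes f: "norm (f u - f s) \<le> A * (t - s) powr \<alpha>" and g: "holder_ball \<beta> G g"
    and st: "0 \<le> s" "s \<le> u" "u \<le> t" "t \<le> T" and "0 \<le> A"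
  shows "norm (blinfun_apply (f s) (g t - g s) - blinfun_apply (f s) (g u - g s) - blinfun_apply (f u) (g t - g u))
           \<le> A * G * (t - s) powr \<theta>"
proof -
  have "blinfun_apply (f s) (g t - g s) - blinfun_apply (f s) (g u - g s) - blinfun_apply (f u) (g t - g u)
      = - blinfun_apply (f u - f s) (g t - g u)"
    by (simp add: blinfun.bilinear_simps)
  also have "norm \<dots> \<le> norm (f u - f s) * norm (g t - g u)"
    by (simp add: norm_blinfun)
  also have "\<dots> \<le> (A * (t - s) powr \<alpha>) * (G * (t - s) powr \<beta>)"
  proof (rule mult_mono[OF f])
    have "norm (g t - g u) \<le> G * (t - u) powr \<beta>"
      using holder_ball_increment[OF g, of u t] st by simp
    also have "\<dots> \<le> G * (t - s) powr \<beta>"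
      using st holder_ball_nonneg[OF g] \<alpha>_half \<alpha>_less_\<beta> by (intro mult_left_mono powr_mono2) auto
    finally show "norm (g t - g u) \<le> G * (t - s) powr \<beta>" .
  qed (use \<open>0 \<le> A\<close> in auto)
  also have "\<dots> = A * G * (t - s) powr \<theta>" by (simp add: powr_add)
  finally show ?thesis .
qed

lemma young_sewing:
  fixes f :: "real \<Rightarrow> 'v::real_normed_vector \<Rightarrow>\<^sub>L 'x::banach"
  assumes f: "holder_ball \<alpha> R f" and g: "holder_ball \<beta> G g"
  obtains y where "y 0 = 0" "follows_germ (\<kappa> * (R * G)) (\<lambda>s t. blinfun_apply (f s) (g t - g s)) y"
proof -
  have \<delta>: "norm (blinfun_apply (f s) (g t - g s) - blinfun_apply (f s) (g u - g s) - blinfun_apply (f u) (g t - g u))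
           \<le> R * G * (t - s) powr \<theta>" if "0 \<le> s" "s \<le> u" "u \<le> t" "t \<le> T" for s u t
  proof (rule young_germ_defect[OF _ g])
    have "norm (f u - f s) \<le> R * (u - s) powr \<alpha>" using holder_ball_increment[OF f] that by auto
    also have "\<dots> \<le> R * (t - s) powr \<alpha>"
      using that holder_ball_nonneg[OF f] \<alpha>_half by (intro mult_left_mono powr_mono2) auto
    finally show "norm (f u - f s) \<le> R * (t - s) powr \<alpha>" .
  qed (use that holder_ball_nonneg[OF f] in auto)
  have "0 \<le> R * G" using holder_ball_nonneg[OF f] holder_ball_nonneg[OF g] by simp
  then obtain y C where y: "y 0 = 0" "follows_germ C (\<lambda>s t. blinfun_apply (f s) (g t - g s)) y"
    using sewing[of "R * G" "\<lambda>s t. blinfun_apply (f s) (g t - g s)"] \<delta> by auto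
  have "follows_germ (\<kappa> * (R * G)) (\<lambda>s t. blinfun_apply (f s) (g t - g s)) y"
    unfolding follows_germ_def using \<delta> by (intro allI impI germ_local_bound[OF y(2)]) auto
  with y show thesis using that by blast
qed

section \<open>Locally weighted Hoelder bounds\<close>

text \<open>Only increments over lengths at most \<open>h\<close> count, and they may grow like \<open>exp (t / h)\<close>. The restriction
to short lengths makes Young integration gain the factor \<open>h powr (\<beta> - \<alpha>)\<close>; the weight, a Bielecki
weight at the same scale, makes values controllable by increments on all of \<open>{0..T}\<close> with constants
that do not depend on \<open>T\<close>. Fixed-point and absorption arguments therefore work on the whole
interval at once, and no solutions have to be glued.\<close>

definition weighted_holder :: "real \<Rightarrow> real \<Rightarrow> (real \<Rightarrow> 'e::real_normed_vector) \<Rightarrow> bool" where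
  "weighted_holder h N z \<longleftrightarrow> (\<forall>s t. 0 \<le> s \<longrightarrow> s \<le> t \<longrightarrow> t \<le> T \<longrightarrow> t - s \<le> h \<longrightarrow>
     norm (z t - z s) \<le> N * exp (t / h) * (t - s) powr \<alpha>)"

lemma weighted_holderD:
  "weighted_holder h N z \<Longrightarrow> 0 \<le> s \<Longrightarrow> s \<le> t \<Longrightarrow> t \<le> T \<Longrightarrow> t - s \<le> h \<Longrightarrow>
     norm (z t - z s) \<le> N * exp (t / h) * (t - s) powr \<alpha>"
  by (simp add: weighted_holder_def)

lemma weighted_holder_nonneg:
  assumes "weighted_holder h N z" "0 < h"
  shows "0 \<le> N"
proof -
  define t where "t = min h T"
  have "0 < t" using assms T_pos by (simp add: t_def)
  have "0 \<le> norm (z t - z 0)" by simp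
  also have "\<dots> \<le> N * (exp (t / h) * (t - 0) powr \<alpha>)"
    using weighted_holderD[OF assms(1), of 0 t] \<open>0 < t\<close> by (simp add: t_def mult.assoc)
  finally have "0 \<le> N * (exp (t / h) * (t - 0) powr \<alpha>)" .
  moreover have "0 < exp (t / h) * (t - 0) powr \<alpha>" using \<open>0 < t\<close> by simp
  ultimately show ?thesis by (simp only: zero_le_mult_iff) linarith
qed

lemma holder_ball_imp_weighted:
  assumes "holder_ball \<alpha> R z" "0 < h"
  shows "weighted_holder h R z"
  unfolding weighted_holder_def
proof (intro allI impI)
  fix s t assume st: "0 \<le> s" "s \<le> t" "t \<le> T"
  have "norm (z t - z s) \<le> R * (t - s) powr \<alpha>" using holder_ball_increment[OF assms(1) st] .
  also have "\<dots> \<le> R * exp (t / h) * (t - s) powr \<alpha>"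
    using holder_ball_nonneg[OF assms(1)] st assms(2)
    by (intro mult_right_mono) (auto simp: mult_le_cancel_left1)
  finally show "norm (z t - z s) \<le> R * exp (t / h) * (t - s) powr \<alpha>" .
qed

text \<open>Walking back from \<open>t\<close> to \<open>0\<close> in steps of length \<open>h\<close>, the weights decrease by the factor
\<open>exp 1 \<ge> 2\<close> in every step, so the increments sum to at most twice the last one.\<close>

lemma weighted_holder_sup:
  assumes z: "weighted_holder h N z" and h: "0 < h" and t: "0 \<le> t" "t \<le> T"
  shows "norm (z t) \<le> exp (t / h) * (norm (z 0) + 2 * h powr \<alpha> * N)"
proof -
  have N: "0 \<le> N" using weighted_holder_nonneg[OF z h] .
  have "norm (z t) \<le> exp (t / h) * (norm (z 0) + 2 * h powr \<alpha> * N)"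
    if "0 \<le> t" "t \<le> T" "t \<le> (real n + 1) * h" for n t
    using that
  proof (induction n arbitrary: t)
    case 0
    have "norm (z t) \<le> norm (z 0) + norm (z t - z 0)" by (rule norm_triangle_sub)
    also have "\<dots> \<le> exp (t / h) * norm (z 0) + N * exp (t / h) * (t - 0) powr \<alpha>"
      using 0 h by (intro add_mono weighted_holderD[OF z]) (auto simp: mult_le_cancel_right1)
    also have "N * exp (t / h) * (t - 0) powr \<alpha> \<le> N * exp (t / h) * h powr \<alpha>"
      using 0 N \<alpha>_half by (intro mult_left_mono powr_mono2) auto
    also have "exp (t / h) * norm (z 0) + N * exp (t / h) * h powr \<alpha> \<le> exp (t / h) * (norm (z 0) + 2 * h powr \<alpha> * N)"
      using N by (simp add: algebra_simps)
    finally show ?case by simp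
  next
    case (Suc n)
    show ?case
    proof (cases "t \<le> h")
      case True
      show ?thesis
      proof (rule Suc.IH)
        show "t \<le> (real n + 1) * h" proof -
          have "0 \<le> real n * h" using h by simp
          then show ?thesis using True by (simp add: distrib_right)
        qed
      qed (use Suc.prems in auto)
    next
      case False
      define B where "B = norm (z 0) + 2 * h powr \<alpha> * N"
      have B: "0 \<le> B" using N by (simp add: B_def)
      have IH: "norm (z (t - h)) \<le> exp ((t - h) / h) * B"
        unfolding B_def using False Suc.prems h by (intro Suc.IH) (auto simp: algebra_simps)
      have "(2::real) \<le> exp 1" using exp_ge_add_one_self[of 1] by simp
      then have "exp ((t - h) / h) * 2 \<le> exp ((t - h) / h) * exp 1" by (intro mult_left_mono) auto
      also have "\<dots> = exp (t / h)" using h by (simp add: exp_add[symmetric] field_simps)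
      finally have e: "exp ((t - h) / h) \<le> exp (t / h) / 2" by simp
      have "norm (z t) \<le> norm (z (t - h)) + norm (z t - z (t - h))" by (rule norm_triangle_sub)
      also have "\<dots> \<le> exp (t / h) / 2 * B + N * exp (t / h) * (t - (t - h)) powr \<alpha>"
        using False Suc.prems h e B
        by (intro add_mono order.trans[OF IH] mult_right_mono weighted_holderD[OF z]) auto
      also have "\<dots> \<le> exp (t / h) * B"
      proof -
        have "B / 2 + N * h powr \<alpha> \<le> B" using N by (simp add: B_def field_simps)
        then have "exp (t / h) * (B / 2 + N * h powr \<alpha>) \<le> exp (t / h) * B" by (intro mult_left_mono) auto
        then show ?thesis by (simp add: algebra_simps)
      qed
      finally show ?thesis by (simp add: B_def)
    qed
  qed
  moreover have "t \<le> (real (nat \<lceil>t / h\<rceil>) + 1) * h"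
  proof -
    have "t / h \<le> real (nat \<lceil>t / h\<rceil>) + 1" using real_nat_ceiling_ge[of "t / h"] by linarith
    then show ?thesis using h by (simp add: pos_divide_le_eq)
  qed
  ultimately show ?thesis using t by blast
qed

lemma weighted_imp_holder_ball:
  assumes z: "weighted_holder h N z" and h: "0 < h" "h \<le> 1"
  shows "holder_ball \<alpha> (4 * exp (T / h) / h powr \<alpha> * (norm (z 0) + N)) z"
proof -
  have N: "0 \<le> N" using weighted_holder_nonneg[OF z h(1)] .
  have h\<alpha>: "h powr \<alpha> \<le> 1" "0 < h powr \<alpha>" using h \<alpha>_half powr_mono2[of \<alpha> h 1] by auto
  define E where "E = exp (T / h)"
  have E: "0 < E" by (simp add: E_def)
  define B where "B = norm (z 0) + 2 * N"
  have B: "0 \<le> B" using N by (simp add: B_def)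
  have sup: "norm (z t) \<le> E * B" if "0 \<le> t" "t \<le> T" for t
  proof -
    have "norm (z t) \<le> exp (t / h) * (norm (z 0) + 2 * h powr \<alpha> * N)"
      by (rule weighted_holder_sup[OF z h(1) that])
    also have "\<dots> \<le> E * B"
      unfolding E_def B_def using that h h\<alpha> N
      by (intro mult_mono add_mono mult_right_mono) (auto simp: divide_right_mono)
    finally show ?thesis .
  qed
  have le: "E * B \<le> 4 * E / h powr \<alpha> * (norm (z 0) + N)"
  proof -
    have "B \<le> 4 * (norm (z 0) + N)" using N by (simp add: B_def)
    also have "\<dots> \<le> 4 * (norm (z 0) + N) / h powr \<alpha>"
      using h\<alpha> N by (simp add: pos_le_divide_eq mult_left_le)
    finally have "E * B \<le> E * (4 * (norm (z 0) + N) / h powr \<alpha>)" using E by (intro mult_left_mono) auto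
    then show ?thesis by (simp add: mult_ac)
  qed
  have "norm (z t - z s) \<le> 4 * E / h powr \<alpha> * (norm (z 0) + N) * (t - s) powr \<alpha>"
    if st: "0 \<le> s" "s \<le> t" "t \<le> T" for s t
  proof (cases "t - s \<le> h")
    case True
    have "norm (z t - z s) \<le> N * exp (t / h) * (t - s) powr \<alpha>" using weighted_holderD[OF z st True] .
    also have "\<dots> \<le> E * B * (t - s) powr \<alpha>"
      unfolding B_def E_def using N h st
      by (intro mult_right_mono) (auto simp: mult.commute[of N] divide_right_mono intro!: mult_mono)
    also have "\<dots> \<le> 4 * E / h powr \<alpha> * (norm (z 0) + N) * (t - s) powr \<alpha>"
      using le by (intro mult_right_mono) auto
    finally show ?thesis .
  next
    case False
    have "1 \<le> ((t - s) / h) powr \<alpha>"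
      using False h \<alpha>_half by (intro ge_one_powr_ge_zero) (auto simp: field_simps)
    then have 1: "1 \<le> (t - s) powr \<alpha> / h powr \<alpha>" using h st by (simp add: powr_divide)
    have "norm (z t - z s) \<le> E * B + E * B"
      using st by (intro order.trans[OF norm_triangle_ineq4] add_mono sup) auto
    also have "\<dots> \<le> E * (4 * (norm (z 0) + N)) * 1" using E N by (simp add: B_def algebra_simps)
    also have "\<dots> \<le> E * (4 * (norm (z 0) + N)) * ((t - s) powr \<alpha> / h powr \<alpha>)"
      using 1 E N by (intro mult_left_mono) auto
    finally show ?thesis by (simp add: mult_ac)
  qed
  then show ?thesis using order.trans[OF sup le] by (auto simp: holder_ball_def E_def)
qed

lemma weighted_holder_absorb:
  assumes "weighted_holder h N z" and step: "\<And>N. weighted_holder h N z \<Longrightarrow> weighted_holder h ((N + b) / 2) z"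
  shows "weighted_holder h b z"
proof -
  have "weighted_holder h ((b / 2) / (1 - 1 / 2)) z"
  proof (rule limit_of_absorption[where P = "\<lambda>N. weighted_holder h N z"])
    show "weighted_holder h (1 / 2 * c + b / 2) z" if "weighted_holder h c z" for c
      using step[OF that] by (simp add: field_simps)
    show "weighted_holder h c z" if "X \<longlonglongrightarrow> c" "\<And>n. weighted_holder h (X n) z" for c X
      unfolding weighted_holder_def
    proof (intro allI impI)
      fix s t assume st: "0 \<le> s" "s \<le> t" "t \<le> T" "t - s \<le> h"
      have "(\<lambda>n. X n * exp (t / h) * (t - s) powr \<alpha>) \<longlonglongrightarrow> c * exp (t / h) * (t - s) powr \<alpha>"
        using that(1) by (intro tendsto_mult tendsto_const)
      then show "norm (z t - z s) \<le> c * exp (t / h) * (t - s) powr \<alpha>"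
        by (rule LIMSEQ_le_const) (use weighted_holderD[OF that(2) st] in auto)
    qed
  qed (use assms in auto)
  then show ?thesis by simp
qed

text \<open>The weight at the right end dominates the weights on the whole interval, so the local sewing estimate
applies with the constant \<open>Q * exp (t / h)\<close>. Both error powers \<open>\<beta>\<close> and \<open>\<theta>\<close> exceed \<open>\<alpha>\<close> by at least
\<open>\<beta> - \<alpha>\<close>.\<close>

lemma germ_weighted_bound:
  assumes y: "follows_germ C \<Xi> y" and h: "0 < h" "h \<le> 1"
    and \<Xi>: "\<And>s t. 0 \<le> s \<Longrightarrow> s \<le> t \<Longrightarrow> t \<le> T \<Longrightarrow> t - s \<le> h \<Longrightarrow>
          norm (\<Xi> s t) \<le> P * exp (t / h) * (t - s) powr \<beta>"
    and \<delta>: "\<And>s u t. 0 \<le> s \<Longrightarrow> s \<le> u \<Longrightarrow> u \<le> t \<Longrightarrow> t \<le> T \<Longrightarrow> t - s \<le> h \<Longrightarrow>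
          norm (\<Xi> s t - \<Xi> s u - \<Xi> u t) \<le> Q * exp (t / h) * (t - s) powr \<theta>"
    and "0 \<le> P" "0 \<le> Q"
  shows "weighted_holder h ((P + \<kappa> * Q) * h powr (\<beta> - \<alpha>)) y"
  unfolding weighted_holder_def
proof (intro allI impI)
  fix s t assume st: "0 \<le> s" "s \<le> t" "t \<le> T" "t - s \<le> h"
  define d where "d = t - s"
  define e where "e = exp (t / h)"
  have d: "0 \<le> d" "d \<le> h" using st by (auto simp: d_def)
  have e: "0 < e" by (simp add: e_def)
  have le: "d powr \<gamma> \<le> h powr (\<beta> - \<alpha>) * d powr \<alpha>" if "\<beta> \<le> \<gamma>" for \<gamma>
  proof -
    have "d powr (\<gamma> - \<alpha>) \<le> d powr (\<beta> - \<alpha>)"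
      using d h that \<alpha>_less_\<beta> by (cases "d = 0") (auto intro!: powr_mono')
    also have "\<dots> \<le> h powr (\<beta> - \<alpha>)" using d \<alpha>_less_\<beta> by (intro powr_mono2) auto
    finally have "d powr (\<gamma> - \<alpha>) * d powr \<alpha> \<le> h powr (\<beta> - \<alpha>) * d powr \<alpha>"
      by (intro mult_right_mono) auto
    then show ?thesis by (simp add: powr_add[symmetric])
  qed
  have "norm (y t - y s - \<Xi> s t) \<le> \<kappa> * (Q * e) * d powr \<theta>"
    unfolding d_def
  proof (rule germ_local_bound[OF y st(1-3)])
    fix r u v assume "s \<le> r" "r \<le> u" "u \<le> v" "v \<le> t"
    then have "norm (\<Xi> r v - \<Xi> r u - \<Xi> u v) \<le> Q * exp (v / h) * (v - r) powr \<theta>"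
      using st by (intro \<delta>) auto
    also have "\<dots> \<le> Q * e * (v - r) powr \<theta>"
      using \<open>v \<le> t\<close> h \<open>0 \<le> Q\<close> unfolding e_def
      by (intro mult_right_mono mult_left_mono) (auto simp: divide_right_mono)
    finally show "norm (\<Xi> r v - \<Xi> r u - \<Xi> u v) \<le> Q * e * (v - r) powr \<theta>" .
  qed
  moreover have "norm (\<Xi> s t) \<le> P * e * d powr \<beta>" using \<Xi>[OF st] by (simp add: d_def e_def)
  moreover have "norm (y t - y s) \<le> norm (\<Xi> s t) + norm (y t - y s - \<Xi> s t)" by (rule norm_triangle_sub)
  ultimately have "norm (y t - y s) \<le> P * e * d powr \<beta> + \<kappa> * (Q * e) * d powr \<theta>" by linarith
  also have "\<dots> \<le> P * e * (h powr (\<beta> - \<alpha>) * d powr \<alpha>) + \<kappa> * (Q * e) * (h powr (\<beta> - \<alpha>) * d powr \<alpha>)"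
    using e \<kappa>_pos assms(6,7) \<alpha>_half by (intro add_mono mult_left_mono le) auto
  finally show "norm (y t - y s) \<le> (P + \<kappa> * Q) * h powr (\<beta> - \<alpha>) * exp (t / h) * (t - s) powr \<alpha>"
    by (simp add: e_def d_def algebra_simps)
qed

text \<open>The estimate behind all bounds for the equation. The integrand \<open>f\<close> is controlled linearly by a path \<open>z\<close>
and a constant \<open>V\<close>; the remaining term carries a difference \<open>k\<close> of drivers. With \<open>z\<close> a solution,
\<open>V = 1\<close> and \<open>k = 0\<close>, the lemma expresses the linear growth of the equation; with \<open>z\<close> the difference
of two paths, \<open>V\<close> a bound on the difference of the parameters and \<open>k\<close> the difference of
the drivers, it expresses that integration contracts. If \<open>y = z\<close>, the bound \<open>N\<close> can be absorbed.\<close>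

lemma weighted_holder_step:
  fixes f f' :: "real \<Rightarrow> 'v::real_normed_vector \<Rightarrow>\<^sub>L 'x::real_normed_vector"
  assumes y: "follows_germ C (\<lambda>s t. blinfun_apply (f s) (g t - g s) + blinfun_apply (f' s) (k t - k s)) y"
    and h: "0 < h" "h \<le> 1" and small: "(1 + \<kappa>) * (5 * G * L + R) * h powr (\<beta> - \<alpha>) \<le> 1 / 2"
    and g: "holder_ball \<beta> G g" and f': "holder_ball \<alpha> R f'" and k: "holder_ball \<beta> D k"
    and z: "weighted_holder h N z"
    and f_sup: "\<And>t. 0 \<le> t \<Longrightarrow> t \<le> T \<Longrightarrow> norm (f t) \<le> L * (norm (z t) + V)"
    and f_inc: "\<And>s t. 0 \<le> s \<Longrightarrow> s \<le> t \<Longrightarrow> t \<le> T \<Longrightarrow>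
       norm (f t - f s) \<le> L * ((t - s) powr \<alpha> * (norm (z s) + norm (z t) + 3 * V) + norm (z t - z s))"
    and "0 \<le> L" "0 \<le> V"
  shows "weighted_holder h ((N + (norm (z 0) + V + D)) / 2) y"
proof -
  define a where "a = norm (z 0)"
  have N: "0 \<le> N" using weighted_holder_nonneg[OF z h(1)] .
  have G: "0 \<le> G" and D: "0 \<le> D" and R: "0 \<le> R"
    using holder_ball_nonneg g k f' by blast+
  have a: "0 \<le> a" by (simp add: a_def)
  have h\<alpha>: "h powr \<alpha> \<le> 1" using h \<alpha>_half powr_mono2[of \<alpha> h 1] by auto
  have exp_mono: "exp (s / h) \<le> exp (t / h)" if "s \<le> t" for s t
    using that h by (simp add: divide_right_mono)
  have exp1: "1 \<le> exp (t / h)" if "0 \<le> t" for t using that h by simp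
  have z_sup: "norm (z t) \<le> exp (t / h) * (a + 2 * N)" if "0 \<le> t" "t \<le> T" for t
  proof -
    have "norm (z t) \<le> exp (t / h) * (a + 2 * h powr \<alpha> * N)"
      unfolding a_def by (rule weighted_holder_sup[OF z h(1) that])
    also have "\<dots> \<le> exp (t / h) * (a + 2 * N)"
      using h\<alpha> N by (intro mult_left_mono add_mono) (auto simp: mult_left_le_one_le)
    finally show ?thesis .
  qed
  define P where "P = G * L * (a + 2 * N + V) + R * D"
  define Q where "Q = G * L * (2 * a + 5 * N + 3 * V) + R * D"
  have PQ: "0 \<le> P" "0 \<le> Q" using G a N D R \<open>0 \<le> L\<close> \<open>0 \<le> V\<close> by (auto simp: P_def Q_def)
  have "weighted_holder h ((P + \<kappa> * Q) * h powr (\<beta> - \<alpha>)) y"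
  proof (rule germ_weighted_bound[OF y h _ _ PQ])
    fix s t assume st: "0 \<le> s" "s \<le> t" "t \<le> T" "t - s \<le> h"
    define e where "e = exp (t / h)"
    have "norm (f s) \<le> L * (norm (z s) + V)" using f_sup st by auto
    also have "\<dots> \<le> L * (e * (a + 2 * N) + e * V)"
    proof (intro mult_left_mono add_mono)
      show "norm (z s) \<le> e * (a + 2 * N)"
        using z_sup[of s] exp_mono[of s t] st N a unfolding e_def
        by (meson add_nonneg_nonneg mult_nonneg_nonneg mult_right_mono order.trans zero_le_numeral)
      show "V \<le> e * V" using exp1[of t] st \<open>0 \<le> V\<close> by (simp add: e_def mult_le_cancel_right1)
    qed fact
    finally have fs: "norm (f s) \<le> L * (e * (a + 2 * N + V))" by (simp add: algebra_simps)
    have f's: "norm (f' s) \<le> R * e"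
      using holder_ball_sup[OF f', of s] exp1[of t] st R unfolding e_def
      by (smt (verit) mult_left_le mult_cancel_left1 mult_left_mono)
    have "norm (blinfun_apply (f s) (g t - g s) + blinfun_apply (f' s) (k t - k s))
        \<le> norm (f s) * norm (g t - g s) + norm (f' s) * norm (k t - k s)"
      by (intro order.trans[OF norm_triangle_ineq] add_mono norm_blinfun)
    also have "\<dots> \<le> L * (e * (a + 2 * N + V)) * (G * (t - s) powr \<beta>) + R * e * (D * (t - s) powr \<beta>)"
      using fs f's holder_ball_increment[OF g st(1-3)] holder_ball_increment[OF k st(1-3)]
      by (intro add_mono mult_mono) (use norm_ge_zero order.trans in blast)+
    also have "\<dots> = P * e * (t - s) powr \<beta>" by (simp add: P_def algebra_simps)
    finally show "norm (blinfun_apply (f s) (g t - g s) + blinfun_apply (f' s) (k t - k s)) \<le> P * exp (t / h) * (t - s) powr \<beta>"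
      by (simp add: e_def)
  next
    fix s u t assume st: "0 \<le> s" "s \<le> u" "u \<le> t" "t \<le> T" "t - s \<le> h"
    define e where "e = exp (t / h)"
    have e: "1 \<le> e" using exp1[of t] st by (simp add: e_def)
    have pw: "(u - s) powr \<alpha> \<le> (t - s) powr \<alpha>" using st \<alpha>_half by (intro powr_mono2) auto
    have zb: "norm (z r) \<le> e * (a + 2 * N)" if "0 \<le> r" "r \<le> t" for r
      using z_sup[of r] exp_mono[of r t] st that N a unfolding e_def
      by (meson add_nonneg_nonneg mult_nonneg_nonneg mult_right_mono order.trans zero_le_numeral)
    have Ve: "V \<le> e * V" using e \<open>0 \<le> V\<close> by (simp add: mult_le_cancel_right1)
    have "norm (z u - z s) \<le> N * exp (u / h) * (u - s) powr \<alpha>"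
      using weighted_holderD[OF z, of s u] st by auto
    also have "\<dots> \<le> N * e * (t - s) powr \<alpha>"
      using pw exp_mono[of u t] st N unfolding e_def by (intro mult_mono) auto
    finally have zi: "norm (z u - z s) \<le> N * e * (t - s) powr \<alpha>" .
    have "norm (f u - f s) \<le> L * ((u - s) powr \<alpha> * (norm (z s) + norm (z u) + 3 * V) + norm (z u - z s))"
      using f_inc st by auto
    also have "\<dots> \<le> L * ((t - s) powr \<alpha> * (e * (a + 2 * N) + e * (a + 2 * N) + 3 * (e * V)) + N * e * (t - s) powr \<alpha>)"
      using zb[of s] zb[of u] st Ve pw zi \<open>0 \<le> L\<close> \<open>0 \<le> V\<close>
      by (intro mult_left_mono add_mono mult_mono) auto
    also have "\<dots> = L * (2 * a + 5 * N + 3 * V) * e * (t - s) powr \<alpha>" by (simp add: algebra_simps)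
    finally have fi: "norm (f u - f s) \<le> L * (2 * a + 5 * N + 3 * V) * e * (t - s) powr \<alpha>" .
    have "norm (f' u - f' s) \<le> R * (u - s) powr \<alpha>"
      using holder_ball_increment[OF f', of s u] st by auto
    also have "\<dots> \<le> R * e * (t - s) powr \<alpha>"
      using pw e R by (intro mult_mono) (auto simp: mult_le_cancel_left1)
    finally have f'i: "norm (f' u - f' s) \<le> R * e * (t - s) powr \<alpha>" .
    have 1: "norm (blinfun_apply (f s) (g t - g s) - blinfun_apply (f s) (g u - g s) - blinfun_apply (f u) (g t - g u))
        \<le> L * (2 * a + 5 * N + 3 * V) * e * G * (t - s) powr \<theta>"
      by (rule young_germ_defect[OF fi g st(1-4)]) (use a N e \<open>0 \<le> L\<close> \<open>0 \<le> V\<close> in auto)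
    have 2: "norm (blinfun_apply (f' s) (k t - k s) - blinfun_apply (f' s) (k u - k s) - blinfun_apply (f' u) (k t - k u))
        \<le> R * e * D * (t - s) powr \<theta>"
      by (rule young_germ_defect[OF f'i k st(1-4)]) (use R e in auto)
    have "norm ((blinfun_apply (f s) (g t - g s) + blinfun_apply (f' s) (k t - k s))
        - (blinfun_apply (f s) (g u - g s) + blinfun_apply (f' s) (k u - k s))
        - (blinfun_apply (f u) (g t - g u) + blinfun_apply (f' u) (k t - k u)))
      = norm ((blinfun_apply (f s) (g t - g s) - blinfun_apply (f s) (g u - g s) - blinfun_apply (f u) (g t - g u))
      + (blinfun_apply (f' s) (k t - k s) - blinfun_apply (f' s) (k u - k s) - blinfun_apply (f' u) (k t - k u)))"
      by (simp add: algebra_simps)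
    also have "\<dots> \<le> L * (2 * a + 5 * N + 3 * V) * e * G * (t - s) powr \<theta> + R * e * D * (t - s) powr \<theta>"
      by (rule norm_triangle_mono[OF 1 2])
    also have "\<dots> = Q * e * (t - s) powr \<theta>" by (simp add: Q_def algebra_simps)
    finally show "norm ((blinfun_apply (f s) (g t - g s) + blinfun_apply (f' s) (k t - k s))
        - (blinfun_apply (f s) (g u - g s) + blinfun_apply (f' s) (k u - k s))
        - (blinfun_apply (f u) (g t - g u) + blinfun_apply (f' u) (k t - k u))) \<le> Q * exp (t / h) * (t - s) powr \<theta>"
      by (simp add: e_def)
  qed
  moreover have "(P + \<kappa> * Q) * h powr (\<beta> - \<alpha>) \<le> (N + (norm (z 0) + V + D)) / 2"
  proof -
    define S where "S = N + (a + V + D)"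
    have S: "0 \<le> S" using N a D \<open>0 \<le> V\<close> by (simp add: S_def)
    have GL: "0 \<le> G * L" using G \<open>0 \<le> L\<close> by simp
    have "G * L * (a + 2 * N + V) \<le> G * L * (5 * S)" "G * L * (2 * a + 5 * N + 3 * V) \<le> G * L * (5 * S)"
      using N a D \<open>0 \<le> V\<close> GL by (auto simp: S_def intro!: mult_left_mono)
    moreover have "R * D \<le> R * S" using N a D \<open>0 \<le> V\<close> R by (auto simp: S_def intro!: mult_left_mono)
    ultimately have PS: "P \<le> (5 * G * L + R) * S" and QS: "Q \<le> (5 * G * L + R) * S"
      by (auto simp: P_def Q_def algebra_simps)
    have "P + \<kappa> * Q \<le> (5 * G * L + R) * S + \<kappa> * ((5 * G * L + R) * S)"
      using PS QS \<kappa>_pos by (intro add_mono mult_left_mono) auto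
    then have "(P + \<kappa> * Q) * h powr (\<beta> - \<alpha>) \<le> ((1 + \<kappa>) * (5 * G * L + R) * S) * h powr (\<beta> - \<alpha>)"
      by (intro mult_right_mono) (auto simp: algebra_simps)
    also have "\<dots> = ((1 + \<kappa>) * (5 * G * L + R) * h powr (\<beta> - \<alpha>)) * S" by (simp add: mult_ac)
    also have "\<dots> \<le> 1 / 2 * S" using small S by (intro mult_right_mono) auto
    finally show ?thesis by (simp add: S_def a_def)
  qed
  ultimately show ?thesis
    unfolding weighted_holder_def by (meson exp_ge_zero mult_right_mono order.trans powr_ge_zero)
qed

lemma small_step_exists:
  obtains h where "0 < h" "h \<le> 1" "c * h powr (\<beta> - \<alpha>) \<le> 1 / 2"
proof -
  define c' where "c' = \<bar>c\<bar> + 1"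
  have c': "1 \<le> c'" "c \<le> c'" by (auto simp: c'_def)
  define h where "h = (1 / (2 * c')) powr (1 / (\<beta> - \<alpha>))"
  have "h powr (\<beta> - \<alpha>) = 1 / (2 * c')" using c' \<alpha>_less_\<beta> by (simp add: h_def powr_powr)
  moreover have "0 < h" using c' by (simp add: h_def)
  moreover have "h \<le> 1" unfolding h_def using c' \<alpha>_less_\<beta> by (intro powr_le1) auto
  moreover have "c * (1 / (2 * c')) \<le> 1 / 2" using c' by (simp add: field_simps)
  ultimately show thesis using that by metis
qed

end

section \<open>Coefficients along Hoelder paths\<close>

text \<open>The mean value inequality for \<open>r \<mapsto> F (p0 + r * (p1 - p0)) - G (q0 + r * (q1 - q0))\<close>. Comparing two
increments through one function of \<open>r\<close> avoids integrating the derivative along the segments.\<close>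

lemma mean_value_two_segments:
  fixes F :: "'y::real_normed_vector \<Rightarrow> 'e::real_normed_vector" and G :: "'z::real_normed_vector \<Rightarrow> 'e"
  assumes F: "\<And>y. (F has_derivative blinfun_apply (D y)) (at y)"
    and G: "\<And>z. (G has_derivative blinfun_apply (E z)) (at z)"
    and bound: "\<And>r. 0 \<le> r \<Longrightarrow> r \<le> 1 \<Longrightarrow>
      norm (blinfun_apply (D (p0 + r *\<^sub>R (p1 - p0))) (p1 - p0)
          - blinfun_apply (E (q0 + r *\<^sub>R (q1 - q0))) (q1 - q0)) \<le> B"
  shows "norm ((F p1 - F p0) - (G q1 - G q0)) \<le> B"
proof -
  define \<phi> where "\<phi> r = F (p0 + r *\<^sub>R (p1 - p0)) - G (q0 + r *\<^sub>R (q1 - q0))" for r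
  define v where "v r = blinfun_apply (D (p0 + r *\<^sub>R (p1 - p0))) (p1 - p0)
      - blinfun_apply (E (q0 + r *\<^sub>R (q1 - q0))) (q1 - q0)" for r
  have "norm (\<phi> 1 - \<phi> 0) \<le> B * norm (1 - 0 :: real)"
  proof (rule differentiable_bound[where S = "{0..1}" and f' = "\<lambda>r h. h *\<^sub>R v r"])
    show "(\<phi> has_derivative (\<lambda>h. h *\<^sub>R v r)) (at r within {0..1})" for r
    proof -
      have "((\<lambda>r. p0 + r *\<^sub>R (p1 - p0)) has_derivative (\<lambda>h. h *\<^sub>R (p1 - p0))) (at r within {0..1})"
        "((\<lambda>r. q0 + r *\<^sub>R (q1 - q0)) has_derivative (\<lambda>h. h *\<^sub>R (q1 - q0))) (at r within {0..1})"
        by (auto intro!: derivative_eq_intros)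
      from has_derivative_compose[OF this(1) F] has_derivative_compose[OF this(2) G]
      show ?thesis unfolding \<phi>_def v_def
        by (rule has_derivative_eq_rhs[OF has_derivative_diff])
          (auto simp: blinfun.bilinear_simps algebra_simps)
    qed
    show "onorm (\<lambda>h. h *\<^sub>R v r) \<le> B" if "r \<in> {0..1}" for r
      using bound[of r] that by (intro onorm_le) (auto simp: v_def mult.commute[of B] intro!: mult_left_mono)
  qed auto
  then show ?thesis by (simp add: \<phi>_def algebra_simps)
qed

context young_exponents
begin

lemma holder_ball_diff:
  assumes "holder_ball \<gamma> R f" "holder_ball \<gamma> S g"
  shows "holder_ball \<gamma> (R + S) (\<lambda>t. f t - g t)"
proof -
  have "norm (f t - g t) \<le> R + S" if "0 \<le> t" "t \<le> T" for t
    using norm_triangle_ineq4[of "f t" "g t"] holder_ball_sup[OF assms(1) that] holder_ball_sup[OF assms(2) that]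
    by linarith
  moreover have "norm ((f t - g t) - (f s - g s)) \<le> (R + S) * (t - s) powr \<gamma>"
    if "0 \<le> s" "s \<le> t" "t \<le> T" for s t
  proof -
    have "(f t - g t) - (f s - g s) = (f t - f s) - (g t - g s)" by simp
    also have "norm \<dots> \<le> norm (f t - f s) + norm (g t - g s)" by (rule norm_triangle_ineq4)
    finally show ?thesis
      using holder_ball_increment[OF assms(1) that] holder_ball_increment[OF assms(2) that]
      unfolding distrib_right by linarith
  qed
  ultimately show ?thesis by (simp add: holder_ball_def)
qed

lemma holder_ball_segment:
  assumes x: "holder_ball \<gamma> R x" and y: "holder_ball \<gamma> R y" and r: "0 \<le> r" "r \<le> 1"
  shows "holder_ball \<gamma> R (\<lambda>t. y t + r *\<^sub>R (x t - y t))"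
proof -
  have conv: "norm (b + r *\<^sub>R (a - b)) \<le> c" if "norm a \<le> c" "norm b \<le> c" for a b :: 'a and c
  proof -
    have "b + r *\<^sub>R (a - b) = (1 - r) *\<^sub>R b + r *\<^sub>R a" by (simp add: algebra_simps)
    moreover have "norm ((1 - r) *\<^sub>R b + r *\<^sub>R a) \<le> (1 - r) * norm b + r * norm a"
      using norm_triangle_ineq[of "(1 - r) *\<^sub>R b" "r *\<^sub>R a"] r by simp
    moreover have "(1 - r) * norm b + r * norm a \<le> c" using that r by (intro convex_bound_le) auto
    ultimately show ?thesis by simp
  qed
  have inc: "(y t + r *\<^sub>R (x t - y t)) - (y s + r *\<^sub>R (x s - y s))
      = (y t - y s) + r *\<^sub>R ((x t - x s) - (y t - y s))" for s t
    by (simp add: algebra_simps)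
  show ?thesis using x y unfolding holder_ball_def inc by (auto intro!: conv)
qed

text \<open>The common form of the hypotheses on the derivatives of the coefficient, in space and time jointly:
the continuous functions that bound the constants are replaced by their maxima on compact sets.\<close>

definition loc_lipschitz_coeff ::
    "(real \<Rightarrow> 'a::real_normed_vector \<Rightarrow> 'b::real_normed_vector \<Rightarrow> 'e::real_normed_vector) \<Rightarrow> bool" where
  "loc_lipschitz_coeff F \<longleftrightarrow> (\<forall>R. \<exists>L\<ge>0. \<forall>s\<in>{0..T}. \<forall>t\<in>{0..T}. \<forall>a a' b b'.
     norm a \<le> R \<longrightarrow> norm a' \<le> R \<longrightarrow> norm b \<le> R \<longrightarrow> norm b' \<le> R \<longrightarrow>
     norm (F t a b - F s a' b') \<le> L * (\<bar>t - s\<bar> powr \<alpha> + norm (a - a') + norm (b - b')))"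

text \<open>The sharper property of the coefficient itself: \<open>b\<close> is not confined to a bounded set and enters at most
linearly, which together with boundedness excludes explosion.\<close>

definition linear_growth_coeff ::
    "(real \<Rightarrow> 'a::real_normed_vector \<Rightarrow> 'b::real_normed_vector \<Rightarrow> 'e::real_normed_vector) \<Rightarrow> bool" where
  "linear_growth_coeff F \<longleftrightarrow> (\<forall>R. \<exists>L\<ge>0. \<forall>s\<in>{0..T}. \<forall>t\<in>{0..T}. \<forall>a a' b b'.
     norm a \<le> R \<longrightarrow> norm a' \<le> R \<longrightarrow>
     norm (F t a b - F s a' b') \<le> L * ((1 + norm b + norm b') * (\<bar>t - s\<bar> powr \<alpha> + norm (a - a')) + norm (b - b')))"

lemma linear_growth_imp_loc_lipschitz:
  fixes F :: "real \<Rightarrow> 'a::real_normed_vector \<Rightarrow> 'b::real_normed_vector \<Rightarrow> 'e::real_normed_vector"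
  assumes "linear_growth_coeff F"
  shows "loc_lipschitz_coeff F"
  unfolding loc_lipschitz_coeff_def
proof
  fix R
  obtain L where L: "L \<ge> 0" "\<forall>s\<in>{0..T}. \<forall>t\<in>{0..T}. \<forall>a a' b b'.
     norm a \<le> R \<longrightarrow> norm a' \<le> R \<longrightarrow>
     norm (F t a b - F s a' b') \<le> L * ((1 + norm b + norm b') * (\<bar>t - s\<bar> powr \<alpha> + norm (a - a')) + norm (b - b'))"
    using assms unfolding linear_growth_coeff_def by blast
  define R' where "R' = \<bar>R\<bar>"
  show "\<exists>L\<ge>0. \<forall>s\<in>{0..T}. \<forall>t\<in>{0..T}. \<forall>a a' b b'.
     norm a \<le> R \<longrightarrow> norm a' \<le> R \<longrightarrow> norm b \<le> R \<longrightarrow> norm b' \<le> R \<longrightarrow>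
     norm (F t a b - F s a' b') \<le> L * (\<bar>t - s\<bar> powr \<alpha> + norm (a - a') + norm (b - b'))"
  proof (intro exI[of _ "L * (1 + 2 * R')"] conjI ballI allI impI)
    show "0 \<le> L * (1 + 2 * R')" using L(1) by (simp add: R'_def)
    fix s t and a a' :: 'a and b b' :: 'b
    assume *: "s \<in> {0..T}" "t \<in> {0..T}" "norm a \<le> R" "norm a' \<le> R" "norm b \<le> R" "norm b' \<le> R"
    define u where "u = \<bar>t - s\<bar> powr \<alpha> + norm (a - a')"
    have u: "0 \<le> u" by (simp add: u_def)
    have R': "R \<le> R'" "0 \<le> R'" by (auto simp: R'_def)
    have "norm (F t a b - F s a' b') \<le> L * ((1 + norm b + norm b') * u + norm (b - b'))"
      using L(2) * unfolding u_def by blast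
    also have "\<dots> \<le> L * ((1 + 2 * R') * u + (1 + 2 * R') * norm (b - b'))"
    proof (intro mult_left_mono add_mono L(1))
      show "(1 + norm b + norm b') * u \<le> (1 + 2 * R') * u" using * R' u by (intro mult_right_mono) auto
      show "norm (b - b') \<le> (1 + 2 * R') * norm (b - b')"
        using R' mult_right_mono[of 1 "1 + 2 * R'" "norm (b - b')"] by simp
    qed
    finally show "norm (F t a b - F s a' b') \<le> L * (1 + 2 * R') * (\<bar>t - s\<bar> powr \<alpha> + norm (a - a') + norm (b - b'))"
      by (simp add: u_def algebra_simps)
  qed
qed

lemma nice_bounds_imp_linear_growth:
  fixes F :: "real \<Rightarrow> 'a::real_normed_vector \<Rightarrow> 'b::real_normed_vector \<Rightarrow> 'e::real_normed_vector"
  assumes c: "continuous_on UNIV c" and d: "continuous_on UNIV d"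
    and space: "nice_space_bound c F" and time: "nice_time_bound \<alpha> d F"
  shows "linear_growth_coeff F"
  unfolding linear_growth_coeff_def
proof
  fix R :: real
  have "bounded (c ` ({0..T} \<times> {0..R} \<times> {0..R}))"
    by (intro compact_imp_bounded compact_continuous_image compact_Times)
      (auto intro: continuous_on_subset[OF c])
  then obtain C where C: "\<And>p. p \<in> {0..T} \<times> {0..R} \<times> {0..R} \<Longrightarrow> norm (c p) \<le> C"
    unfolding bounded_iff by blast
  have "bounded (d ` {0..R})"
    by (intro compact_imp_bounded compact_continuous_image) (auto intro: continuous_on_subset[OF d])
  then obtain C' where C': "\<And>r. r \<in> {0..R} \<Longrightarrow> norm (d r) \<le> C'"
    unfolding bounded_iff by blast
  define L where "L = \<bar>C\<bar> + \<bar>C'\<bar>"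
  show "\<exists>L\<ge>0. \<forall>s\<in>{0..T}. \<forall>t\<in>{0..T}. \<forall>a a' b b'. norm a \<le> R \<longrightarrow> norm a' \<le> R \<longrightarrow>
     norm (F t a b - F s a' b') \<le> L * ((1 + norm b + norm b') * (\<bar>t - s\<bar> powr \<alpha> + norm (a - a')) + norm (b - b'))"
  proof (intro exI[of _ L] conjI ballI allI impI)
    show "0 \<le> L" by (simp add: L_def)
    fix s t and a a' :: 'a and b b' :: 'b
    assume *: "s \<in> {0..T}" "t \<in> {0..T}" "norm a \<le> R" "norm a' \<le> R"
    define B where "B = 1 + norm b + norm b'"
    have B: "0 \<le> B" by (simp add: B_def)
    have "norm (F t a b - F t a' b') \<le> c (t, norm a, norm a') * (norm (b - b') + B * norm (a - a'))"
      using space unfolding nice_space_bound_def B_def by blast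
    also have "\<dots> \<le> L * (norm (b - b') + B * norm (a - a'))"
      using C[of "(t, norm a, norm a')"] * B by (intro mult_right_mono) (auto simp: L_def)
    finally have 1: "norm (F t a b - F t a' b') \<le> L * (norm (b - b') + B * norm (a - a'))" .
    have "norm (F t a' b' - F s a' b') \<le> d (norm a') * (1 + norm b') * \<bar>t - s\<bar> powr \<alpha>"
      using time unfolding nice_time_bound_def by blast
    also have "\<dots> \<le> L * B * \<bar>t - s\<bar> powr \<alpha>"
      using C'[of "norm a'"] * by (intro mult_right_mono mult_mono) (auto simp: L_def B_def)
    finally have 2: "norm (F t a' b' - F s a' b') \<le> L * B * \<bar>t - s\<bar> powr \<alpha>" .
    have "norm (F t a b - F s a' b') \<le> L * (norm (b - b') + B * norm (a - a')) + L * B * \<bar>t - s\<bar> powr \<alpha>"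
      using norm_triangle_mono[OF 1 2] by simp
    also have "\<dots> = L * (B * (\<bar>t - s\<bar> powr \<alpha> + norm (a - a')) + norm (b - b'))"
      by (simp add: algebra_simps)
    finally show "norm (F t a b - F s a' b') \<le> L * ((1 + norm b + norm b') * (\<bar>t - s\<bar> powr \<alpha> + norm (a - a')) + norm (b - b'))"
      by (simp add: B_def)
  qed
qed

lemma condition_d_bounds_imp_loc_lipschitz:
  fixes F :: "real \<Rightarrow> 'a::real_normed_vector \<Rightarrow> 'b::real_normed_vector \<Rightarrow> 'e::real_normed_vector"
    and c :: "real \<times> real \<times> real \<times> real \<times> real \<Rightarrow> real" and d :: "real \<times> real \<Rightarrow> real"
  assumes c: "continuous_on UNIV c" and d: "continuous_on UNIV d"
    and space: "\<And>t a a' b b'. norm (F t a b - F t a' b') \<le>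
        c (t, norm a, norm a', norm b, norm b') * (norm (b - b') + norm (a - a'))"
    and time: "\<And>t s a b. norm (F t a b - F s a b) \<le> d (norm a, norm b) * \<bar>t - s\<bar> powr \<alpha>"
  shows "loc_lipschitz_coeff F"
  unfolding loc_lipschitz_coeff_def
proof
  fix R :: real
  have "bounded (c ` ({0..T} \<times> {0..R} \<times> {0..R} \<times> {0..R} \<times> {0..R}))"
    by (intro compact_imp_bounded compact_continuous_image compact_Times)
      (auto intro: continuous_on_subset[OF c])
  then obtain C where C: "\<And>p. p \<in> {0..T} \<times> {0..R} \<times> {0..R} \<times> {0..R} \<times> {0..R} \<Longrightarrow> norm (c p) \<le> C"
    unfolding bounded_iff by blast
  have "bounded (d ` ({0..R} \<times> {0..R}))"
    by (intro compact_imp_bounded compact_continuous_image compact_Times) (auto intro: continuous_on_subset[OF d])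
  then obtain C' where C': "\<And>r. r \<in> {0..R} \<times> {0..R} \<Longrightarrow> norm (d r) \<le> C'"
    unfolding bounded_iff by blast
  define L where "L = \<bar>C\<bar> + \<bar>C'\<bar>"
  show "\<exists>L\<ge>0. \<forall>s\<in>{0..T}. \<forall>t\<in>{0..T}. \<forall>a a' b b'.
     norm a \<le> R \<longrightarrow> norm a' \<le> R \<longrightarrow> norm b \<le> R \<longrightarrow> norm b' \<le> R \<longrightarrow>
     norm (F t a b - F s a' b') \<le> L * (\<bar>t - s\<bar> powr \<alpha> + norm (a - a') + norm (b - b'))"
  proof (intro exI[of _ L] conjI ballI allI impI)
    show "0 \<le> L" by (simp add: L_def)
    fix s t and a a' :: 'a and b b' :: 'b
    assume *: "s \<in> {0..T}" "t \<in> {0..T}" "norm a \<le> R" "norm a' \<le> R" "norm b \<le> R" "norm b' \<le> R"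
    have "norm (F t a b - F t a' b') \<le> c (t, norm a, norm a', norm b, norm b') * (norm (b - b') + norm (a - a'))"
      by (rule space)
    also have "\<dots> \<le> L * (norm (b - b') + norm (a - a'))"
      using C[of "(t, norm a, norm a', norm b, norm b')"] * by (intro mult_right_mono) (auto simp: L_def)
    finally have 1: "norm (F t a b - F t a' b') \<le> L * (norm (b - b') + norm (a - a'))" .
    have "norm (F t a' b' - F s a' b') \<le> d (norm a', norm b') * \<bar>t - s\<bar> powr \<alpha>"
      by (rule time)
    also have "\<dots> \<le> L * \<bar>t - s\<bar> powr \<alpha>"
      using C'[of "(norm a', norm b')"] * by (intro mult_right_mono) (auto simp: L_def)
    finally have 2: "norm (F t a' b' - F s a' b') \<le> L * \<bar>t - s\<bar> powr \<alpha>" .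
    show "norm (F t a b - F s a' b') \<le> L * (\<bar>t - s\<bar> powr \<alpha> + norm (a - a') + norm (b - b'))"
      using norm_triangle_mono[OF 1 2] by (simp add: algebra_simps)
  qed
qed

lemma loc_lipschitz_coeff_flip:
  "loc_lipschitz_coeff F \<Longrightarrow> loc_lipschitz_coeff (\<lambda>t b a. F t a b)"
  unfolding loc_lipschitz_coeff_def by (simp add: add_ac) meson

lemma coefficient_along_paths:
  fixes F :: "real \<Rightarrow> 'a::real_normed_vector \<Rightarrow> 'b::real_normed_vector \<Rightarrow> 'e::real_normed_vector"
  assumes "loc_lipschitz_coeff F"
  obtains L where "0 \<le> L"
    "\<And>a b. holder_ball \<alpha> R a \<Longrightarrow> holder_ball \<alpha> R b \<Longrightarrow> holder_ball \<alpha> L (\<lambda>t. F t (a t) (b t))"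
proof -
  obtain L where L: "L \<ge> 0" "\<forall>s\<in>{0..T}. \<forall>t\<in>{0..T}. \<forall>a a' b b'.
     norm a \<le> \<bar>R\<bar> \<longrightarrow> norm a' \<le> \<bar>R\<bar> \<longrightarrow> norm b \<le> \<bar>R\<bar> \<longrightarrow> norm b' \<le> \<bar>R\<bar> \<longrightarrow>
     norm (F t a b - F s a' b') \<le> L * (\<bar>t - s\<bar> powr \<alpha> + norm (a - a') + norm (b - b'))"
    using assms unfolding loc_lipschitz_coeff_def by blast
  define K where "K = norm (F 0 0 0) + L * (T powr \<alpha> + \<bar>R\<bar> + \<bar>R\<bar>) + L * (1 + \<bar>R\<bar> + \<bar>R\<bar>)"
  have K1: "norm (F 0 0 0) + L * (T powr \<alpha> + \<bar>R\<bar> + \<bar>R\<bar>) \<le> K" and K2: "L * (1 + \<bar>R\<bar> + \<bar>R\<bar>) \<le> K"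
    using L(1) by (auto simp: K_def)
  show thesis
  proof (rule that)
    show "0 \<le> K" using L(1) by (simp add: K_def)
    fix a :: "real \<Rightarrow> 'a" and b :: "real \<Rightarrow> 'b"
    assume a: "holder_ball \<alpha> R a" and b: "holder_ball \<alpha> R b"
    have R: "\<bar>R\<bar> = R" using holder_ball_nonneg[OF a] by simp
    show "holder_ball \<alpha> K (\<lambda>t. F t (a t) (b t))"
      unfolding holder_ball_def
    proof (intro conjI allI impI)
      fix t assume t: "0 \<le> t" "t \<le> T"
      have ab: "norm (a t) \<le> R" "norm (b t) \<le> R" using holder_ball_sup t a b by blast+
      have "norm (F t (a t) (b t) - F 0 0 0) \<le> L * (\<bar>t - 0\<bar> powr \<alpha> + norm (a t - 0) + norm (b t - 0))"
        using L(2)[unfolded R, rule_format, of 0 t "a t" 0 "b t" 0] t ab T_pos holder_ball_nonneg[OF a] by simp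
      also have "\<dots> \<le> L * (T powr \<alpha> + R + R)"
        using L(1) t ab \<alpha>_half by (intro mult_left_mono add_mono powr_mono2) auto
      finally have "norm (F t (a t) (b t)) \<le> norm (F 0 0 0) + L * (T powr \<alpha> + R + R)"
        using norm_triangle_sub[of "F t (a t) (b t)" "F 0 0 0"] by linarith
      then show "norm (F t (a t) (b t)) \<le> K" using K1 R by simp
    next
      fix s t assume st: "0 \<le> s" "s \<le> t" "t \<le> T"
      have "norm (a t) \<le> R" "norm (b t) \<le> R" "norm (a s) \<le> R" "norm (b s) \<le> R"
        using holder_ball_sup st a b by (meson order.trans)+
      then have "norm (F t (a t) (b t) - F s (a s) (b s)) \<le> L * (\<bar>t - s\<bar> powr \<alpha> + norm (a t - a s) + norm (b t - b s))"
        using L(2)[unfolded R, rule_format, of s t "a t" "a s" "b t" "b s"] st by simp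
      also have "\<dots> \<le> L * ((t - s) powr \<alpha> + R * (t - s) powr \<alpha> + R * (t - s) powr \<alpha>)"
        using L(1) st holder_ball_increment[OF a st] holder_ball_increment[OF b st]
        by (intro mult_left_mono add_mono) auto
      also have "\<dots> = L * (1 + \<bar>R\<bar> + \<bar>R\<bar>) * (t - s) powr \<alpha>" using R by (simp add: algebra_simps)
      also have "\<dots> \<le> K * (t - s) powr \<alpha>" using K2 by (intro mult_right_mono) auto
      finally show "norm (F t (a t) (b t) - F s (a s) (b s)) \<le> K * (t - s) powr \<alpha>" .
    qed
  qed
qed

text \<open>A Hoelder bound on the derivative along all intermediate paths bounds the increments of the difference
by first-order quantities in \<open>b - b'\<close>. The increment of the derivative
multiplies \<open>b t - b' t\<close>, and the derivative itself multiplies the increment of \<open>b - b'\<close>.\<close>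

lemma difference_in_second_argument:
  fixes F :: "real \<Rightarrow> 'a::real_normed_vector \<Rightarrow> 'b::real_normed_vector \<Rightarrow> 'e::real_normed_vector"
  assumes deriv: "\<And>t a b. ((\<lambda>b. F t a b) has_derivative blinfun_apply (D t a b)) (at b)"
    and D: "loc_lipschitz_coeff D"
  obtains L where "0 \<le> L"
    "\<And>a b b' t. holder_ball \<alpha> R a \<Longrightarrow> holder_ball \<alpha> R b \<Longrightarrow> holder_ball \<alpha> R b' \<Longrightarrow> 0 \<le> t \<Longrightarrow> t \<le> T \<Longrightarrow>
       norm (F t (a t) (b t) - F t (a t) (b' t)) \<le> L * norm (b t - b' t)"
    "\<And>a b b' s t. holder_ball \<alpha> R a \<Longrightarrow> holder_ball \<alpha> R b \<Longrightarrow> holder_ball \<alpha> R b' \<Longrightarrow>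
       0 \<le> s \<Longrightarrow> s \<le> t \<Longrightarrow> t \<le> T \<Longrightarrow>
       norm ((F t (a t) (b t) - F t (a t) (b' t)) - (F s (a s) (b s) - F s (a s) (b' s)))
         \<le> L * ((t - s) powr \<alpha> * norm (b t - b' t) + norm ((b t - b' t) - (b s - b' s)))"
proof -
  obtain L where L: "0 \<le> L"
    "\<And>a b. holder_ball \<alpha> R a \<Longrightarrow> holder_ball \<alpha> R b \<Longrightarrow> holder_ball \<alpha> L (\<lambda>t. D t (a t) (b t))"
    using coefficient_along_paths[OF D] by blast
  show thesis
  proof (rule that[OF L(1)])
    fix a :: "real \<Rightarrow> 'a" and b b' :: "real \<Rightarrow> 'b" and s t
    assume ab: "holder_ball \<alpha> R a" "holder_ball \<alpha> R b" "holder_ball \<alpha> R b'" and st: "0 \<le> s" "s \<le> t" "t \<le> T"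
    show "norm ((F t (a t) (b t) - F t (a t) (b' t)) - (F s (a s) (b s) - F s (a s) (b' s)))
         \<le> L * ((t - s) powr \<alpha> * norm (b t - b' t) + norm ((b t - b' t) - (b s - b' s)))"
    proof (rule mean_value_two_segments[OF deriv deriv])
      fix r :: real assume r: "0 \<le> r" "r \<le> 1"
      define P where "P t = D t (a t) (b' t + r *\<^sub>R (b t - b' t))" for t
      have P: "holder_ball \<alpha> L P"
        unfolding P_def by (rule L(2)[OF ab(1) holder_ball_segment[OF ab(2,3) r]])
      have "blinfun_apply (P t) (b t - b' t) - blinfun_apply (P s) (b s - b' s)
          = blinfun_apply (P t - P s) (b t - b' t) + blinfun_apply (P s) ((b t - b' t) - (b s - b' s))"
        by (simp add: blinfun.bilinear_simps)
      also have "norm \<dots> \<le> norm (P t - P s) * norm (b t - b' t) + norm (P s) * norm ((b t - b' t) - (b s - b' s))"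
        by (intro norm_triangle_mono norm_blinfun)
      also have "\<dots> \<le> (L * (t - s) powr \<alpha>) * norm (b t - b' t) + L * norm ((b t - b' t) - (b s - b' s))"
        using holder_ball_increment[OF P st] holder_ball_sup[OF P, of s] st
        by (intro add_mono mult_right_mono) auto
      finally show "norm (blinfun_apply (D t (a t) (b' t + r *\<^sub>R (b t - b' t))) (b t - b' t)
          - blinfun_apply (D s (a s) (b' s + r *\<^sub>R (b s - b' s))) (b s - b' s))
         \<le> L * ((t - s) powr \<alpha> * norm (b t - b' t) + norm ((b t - b' t) - (b s - b' s)))"
        by (simp add: P_def algebra_simps)
    qed
  next
    fix a :: "real \<Rightarrow> 'a" and b b' :: "real \<Rightarrow> 'b" and t
    assume ab: "holder_ball \<alpha> R a" "holder_ball \<alpha> R b" "holder_ball \<alpha> R b'" and t: "0 \<le> t" "t \<le> T"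
    have "norm ((F t (a t) (b t) - F t (a t) (b' t)) - (0 - 0)) \<le> L * norm (b t - b' t)"
    proof (rule mean_value_two_segments[OF deriv, where E = "\<lambda>_. 0" and G = "\<lambda>_. 0"])
      show "((\<lambda>_. 0) has_derivative blinfun_apply 0) (at z)" for z :: 'b
        by (simp add: zero_blinfun.rep_eq)
      fix r :: real assume r: "0 \<le> r" "r \<le> 1"
      have "norm (D t (a t) (b' t + r *\<^sub>R (b t - b' t))) \<le> L"
        using holder_ball_sup[OF L(2)[OF ab(1) holder_ball_segment[OF ab(2,3) r]] t] .
      then show "norm (blinfun_apply (D t (a t) (b' t + r *\<^sub>R (b t - b' t))) (b t - b' t) - blinfun_apply 0 (0 - 0))
          \<le> L * norm (b t - b' t)"
        by (simp add: zero_blinfun.rep_eq order.trans[OF norm_blinfun mult_right_mono])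
    qed
    then show "norm (F t (a t) (b t) - F t (a t) (b' t)) \<le> L * norm (b t - b' t)" by simp
  qed
qed

end

section \<open>Solutions: a priori bound, stability, existence\<close>

context young_exponents
begin

lemma holder_ball_add:
  assumes "holder_ball \<gamma> R (\<lambda>t. f t - g t)" "holder_ball \<gamma> S g"
  shows "holder_ball \<gamma> (R + S) f"
proof -
  have "- g t - - g s = - (g t - g s)" for s t by simp
  then have "holder_ball \<gamma> S (\<lambda>t. - g t)"
    using assms(2) unfolding holder_ball_def by (simp only: norm_minus_cancel)
  from holder_ball_diff[OF assms(1) this] show ?thesis by simp
qed

lemma follows_germ_diff:
  assumes "follows_germ C \<Xi> y" "follows_germ C' \<Xi>' y'"
  shows "follows_germ (C + C') (\<lambda>s t. \<Xi> s t - \<Xi>' s t) (\<lambda>t. y t - y' t)"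
  unfolding follows_germ_def
proof (intro allI impI)
  fix s t assume st: "0 \<le> s" "s \<le> t" "t \<le> T"
  have "(y t - y' t) - (y s - y' s) - (\<Xi> s t - \<Xi>' s t) = (y t - y s - \<Xi> s t) - (y' t - y' s - \<Xi>' s t)"
    by simp
  also have "norm \<dots> \<le> C * (t - s) powr \<theta> + C' * (t - s) powr \<theta>"
    by (intro order.trans[OF norm_triangle_ineq4] add_mono follows_germD[OF assms(1)] follows_germD[OF assms(2)] st)
  finally show "norm ((y t - y' t) - (y s - y' s) - (\<Xi> s t - \<Xi>' s t)) \<le> (C + C') * (t - s) powr \<theta>"
    by (simp add: distrib_right)
qed

end

locale young_equation = young_exponents +
  fixes \<sigma> :: "real \<Rightarrow> 'w::banach \<Rightarrow> 'x::banach \<Rightarrow> ('v::banach \<Rightarrow>\<^sub>L 'x)"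
    and Dx :: "real \<Rightarrow> 'w \<Rightarrow> 'x \<Rightarrow> ('x \<Rightarrow>\<^sub>L ('v \<Rightarrow>\<^sub>L 'x))"
    and M :: real
  assumes \<sigma>_bounded: "norm (\<sigma> t a b) \<le> M"
    and \<sigma>_growth: "linear_growth_coeff \<sigma>"
    and Dx: "((\<lambda>b. \<sigma> t a b) has_derivative blinfun_apply (Dx t a b)) (at b)"
    and Dx_coeff: "loc_lipschitz_coeff Dx"
begin

abbreviation young_germ :: "(real \<Rightarrow> 'v) \<Rightarrow> (real \<Rightarrow> 'w) \<Rightarrow> (real \<Rightarrow> 'x) \<Rightarrow> real \<Rightarrow> real \<Rightarrow> 'x" where
  "young_germ g w x \<equiv> (\<lambda>s t. blinfun_apply (\<sigma> s (w s) (x s)) (g t - g s))"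

text \<open>Boundedness of the coefficient bounds the values of the integrand by a constant, linear growth bounds its
increments linearly in the path. The scale \<open>h\<close> depends on \<open>R\<close> only, not on the path nor on its initial
value; this is what makes the resulting bound hold up to time \<open>T\<close>.\<close>

lemma growth_step:
  obtains h where "0 < h" "h \<le> 1"
    "\<And>g w x y C N. holder_ball \<beta> R g \<Longrightarrow> holder_ball \<alpha> R w \<Longrightarrow>
       follows_germ C (young_germ g w x) y \<Longrightarrow> weighted_holder h N x \<Longrightarrow>
       weighted_holder h ((N + (norm (x 0) + 1)) / 2) y"
proof -
  obtain L0 where L0: "L0 \<ge> 0" "\<forall>s\<in>{0..T}. \<forall>t\<in>{0..T}. \<forall>a a' b b'. norm a \<le> R \<longrightarrow> norm a' \<le> R \<longrightarrow>
     norm (\<sigma> t a b - \<sigma> s a' b') \<le> L0 * ((1 + norm b + norm b') * (\<bar>t - s\<bar> powr \<alpha> + norm (a - a')) + norm (b - b'))"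
    using \<sigma>_growth unfolding linear_growth_coeff_def by blast
  define L where "L = \<bar>M\<bar> + L0 * (1 + \<bar>R\<bar>)"
  have L: "0 \<le> L" "M \<le> L" "L0 * (1 + \<bar>R\<bar>) \<le> L" using mult_nonneg_nonneg[OF L0(1), of "1 + \<bar>R\<bar>"] unfolding L_def by linarith+
  have "0 \<le> L0 * \<bar>R\<bar>" using L0(1) by simp
  then have "L0 \<le> L0 * (1 + \<bar>R\<bar>)" by (simp add: distrib_left)
  then have L0L: "L0 \<le> L" using L(3) by linarith
  obtain h where h: "0 < h" "h \<le> 1" "(1 + \<kappa>) * (5 * R * L + 0) * h powr (\<beta> - \<alpha>) \<le> 1 / 2"
    by (rule small_step_exists)
  show thesis
  proof (rule that[OF h(1,2)])
    fix g w x y C N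
    assume g: "holder_ball \<beta> R g" and w: "holder_ball \<alpha> R w"
      and y: "follows_germ C (young_germ g w x) y" and x: "weighted_holder h N x"
    have R: "0 \<le> R" using holder_ball_nonneg[OF g] .
    have zero: "holder_ball \<gamma> 0 (\<lambda>_. 0)" for \<gamma> by (simp add: holder_ball_def)
    have "weighted_holder h ((N + (norm (x 0) + 1 + 0)) / 2) y"
    proof (rule weighted_holder_step[OF _ h g zero zero x])
      show "follows_germ C (\<lambda>s t. blinfun_apply (\<sigma> s (w s) (x s)) (g t - g s) + blinfun_apply 0 (0 - 0)) y"
        using y by (simp add: zero_blinfun.rep_eq)
      show "norm (\<sigma> t (w t) (x t)) \<le> L * (norm (x t) + 1)" for t
      proof -
        have "norm (\<sigma> t (w t) (x t)) \<le> L * 1" using \<sigma>_bounded[of t "w t" "x t"] L(2) by linarith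
        also have "\<dots> \<le> L * (norm (x t) + 1)" using L(1) by (intro mult_left_mono) auto
        finally show ?thesis .
      qed
      fix s t assume st: "0 \<le> s" "s \<le> t" "t \<le> T"
      define B where "B = 1 + norm (x t) + norm (x s)"
      have B: "0 \<le> B" by (simp add: B_def)
      have "norm (w s) \<le> R" "norm (w t) \<le> R" using holder_ball_sup[OF w] st by auto
      then have "norm (\<sigma> t (w t) (x t) - \<sigma> s (w s) (x s))
          \<le> L0 * (B * (\<bar>t - s\<bar> powr \<alpha> + norm (w t - w s)) + norm (x t - x s))"
        unfolding B_def using L0(2)[rule_format, of s t "w t" "w s" "x t" "x s"] st by simp
      also have "\<dots> \<le> L0 * (B * ((t - s) powr \<alpha> + R * (t - s) powr \<alpha>) + norm (x t - x s))"
        using L0(1) B st holder_ball_increment[OF w st] by (intro mult_left_mono add_mono) auto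
      also have "\<dots> = (L0 * (1 + \<bar>R\<bar>)) * ((t - s) powr \<alpha> * B) + L0 * norm (x t - x s)"
        using R by (simp add: algebra_simps)
      also have "\<dots> \<le> L * ((t - s) powr \<alpha> * (norm (x s) + norm (x t) + 3 * 1)) + L * norm (x t - x s)"
        using L L0L B by (intro add_mono mult_mono) (auto simp: B_def)
      finally show "norm (\<sigma> t (w t) (x t) - \<sigma> s (w s) (x s))
          \<le> L * ((t - s) powr \<alpha> * (norm (x s) + norm (x t) + 3 * 1) + norm (x t - x s))"
        by (simp add: distrib_left)
    qed (use L(1) in auto)
    then show "weighted_holder h ((N + (norm (x 0) + 1)) / 2) y" by simp
  qed
qed

lemma a_priori_bound:
  obtains R' where
    "\<And>g w x C S. holder_ball \<beta> R g \<Longrightarrow> holder_ball \<alpha> R w \<Longrightarrow> norm (x 0) \<le> R \<Longrightarrow>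
       holder_ball \<alpha> S x \<Longrightarrow> follows_germ C (young_germ g w x) x \<Longrightarrow> holder_ball \<alpha> R' x"
proof -
  obtain h where h: "0 < h" "h \<le> 1" and step: "\<And>g w x y C N. holder_ball \<beta> R g \<Longrightarrow> holder_ball \<alpha> R w \<Longrightarrow>
       follows_germ C (young_germ g w x) y \<Longrightarrow> weighted_holder h N x \<Longrightarrow>
       weighted_holder h ((N + (norm (x 0) + 1)) / 2) y"
    using growth_step[of R] by blast
  show thesis
  proof (rule that)
    fix g w x C S
    assume g: "holder_ball \<beta> R g" and w: "holder_ball \<alpha> R w" and x0: "norm (x 0) \<le> R"
      and x: "holder_ball \<alpha> S x" "follows_germ C (young_germ g w x) x"
    have "weighted_holder h (norm (x 0) + 1) x"
      by (rule weighted_holder_absorb[OF holder_ball_imp_weighted[OF x(1) h(1)] step[OF g w x(2)]])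
    then have "holder_ball \<alpha> (4 * exp (T / h) / h powr \<alpha> * (norm (x 0) + (norm (x 0) + 1))) x"
      by (rule weighted_imp_holder_ball[OF _ h])
    then show "holder_ball \<alpha> (4 * exp (T / h) / h powr \<alpha> * (R + (R + 1))) x"
      by (rule holder_ball_mono) (use x0 in \<open>intro mult_left_mono, auto\<close>)
  qed
qed

text \<open>The difference of the coefficients along \<open>(w, x)\<close> and \<open>(w', x')\<close> is split at \<open>(w, x')\<close>; the first
part needs the derivative in \<open>x\<close>, the second the derivative in \<open>w\<close>. The proposition \<open>smooth_w\<close> records
whether the latter is available; if it is not, the estimate covers the case \<open>w = w'\<close>, in which the
second part vanishes. In contrast to the growth estimate, \<open>h\<close> depends here on a bound for the paths
\<open>x\<close> and \<open>x'\<close> as well.\<close>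

lemma contraction_step:
  fixes Dw :: "real \<Rightarrow> 'w \<Rightarrow> 'x \<Rightarrow> ('w \<Rightarrow>\<^sub>L ('v \<Rightarrow>\<^sub>L 'x))"
  assumes Dw: "\<And>t a b. smooth_w \<Longrightarrow> ((\<lambda>a. \<sigma> t a b) has_derivative blinfun_apply (Dw t a b)) (at a)"
    "smooth_w \<Longrightarrow> loc_lipschitz_coeff Dw"
  obtains h where "0 < h" "h \<le> 1"
    "\<And>g g' w w' x x' y C N V D. holder_ball \<beta> R g \<Longrightarrow> holder_ball \<alpha> R w \<Longrightarrow> holder_ball \<alpha> R w' \<Longrightarrow>
       holder_ball \<alpha> R x \<Longrightarrow> holder_ball \<alpha> R x' \<Longrightarrow> w = w' \<or> smooth_w \<Longrightarrow>
       holder_ball \<beta> D (\<lambda>t. g t - g' t) \<Longrightarrow> holder_ball \<alpha> V (\<lambda>t. w t - w' t) \<Longrightarrow>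
       follows_germ C (\<lambda>s t. young_germ g w x s t - young_germ g' w' x' s t) y \<Longrightarrow>
       weighted_holder h N (\<lambda>t. x t - x' t) \<Longrightarrow>
       weighted_holder h ((N + (norm (x 0 - x' 0) + V + D)) / 2) y"
proof -
  obtain L1 where L1: "0 \<le> L1"
    "\<And>a b b' t. holder_ball \<alpha> R a \<Longrightarrow> holder_ball \<alpha> R b \<Longrightarrow> holder_ball \<alpha> R b' \<Longrightarrow> 0 \<le> t \<Longrightarrow> t \<le> T \<Longrightarrow>
       norm (\<sigma> t (a t) (b t) - \<sigma> t (a t) (b' t)) \<le> L1 * norm (b t - b' t)"
    "\<And>a b b' s t. holder_ball \<alpha> R a \<Longrightarrow> holder_ball \<alpha> R b \<Longrightarrow> holder_ball \<alpha> R b' \<Longrightarrow>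
       0 \<le> s \<Longrightarrow> s \<le> t \<Longrightarrow> t \<le> T \<Longrightarrow>
       norm ((\<sigma> t (a t) (b t) - \<sigma> t (a t) (b' t)) - (\<sigma> s (a s) (b s) - \<sigma> s (a s) (b' s)))
         \<le> L1 * ((t - s) powr \<alpha> * norm (b t - b' t) + norm ((b t - b' t) - (b s - b' s)))"
    using difference_in_second_argument[OF Dx Dx_coeff, of R] by blast
  obtain L2 where L2: "0 \<le> L2"
    "\<And>a a' b t. a = a' \<or> smooth_w \<Longrightarrow> holder_ball \<alpha> R a \<Longrightarrow> holder_ball \<alpha> R a' \<Longrightarrow> holder_ball \<alpha> R b \<Longrightarrow>
       0 \<le> t \<Longrightarrow> t \<le> T \<Longrightarrow>
       norm (\<sigma> t (a t) (b t) - \<sigma> t (a' t) (b t)) \<le> L2 * norm (a t - a' t)"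
    "\<And>a a' b s t. a = a' \<or> smooth_w \<Longrightarrow> holder_ball \<alpha> R a \<Longrightarrow> holder_ball \<alpha> R a' \<Longrightarrow> holder_ball \<alpha> R b \<Longrightarrow>
       0 \<le> s \<Longrightarrow> s \<le> t \<Longrightarrow> t \<le> T \<Longrightarrow>
       norm ((\<sigma> t (a t) (b t) - \<sigma> t (a' t) (b t)) - (\<sigma> s (a s) (b s) - \<sigma> s (a' s) (b s)))
         \<le> L2 * ((t - s) powr \<alpha> * norm (a t - a' t) + norm ((a t - a' t) - (a s - a' s)))"
  proof (cases smooth_w)
    case True
    obtain L where L: "0 \<le> L"
      "\<And>b a a' t. holder_ball \<alpha> R b \<Longrightarrow> holder_ball \<alpha> R a \<Longrightarrow> holder_ball \<alpha> R a' \<Longrightarrow> 0 \<le> t \<Longrightarrow> t \<le> T \<Longrightarrow>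
         norm (\<sigma> t (a t) (b t) - \<sigma> t (a' t) (b t)) \<le> L * norm (a t - a' t)"
      "\<And>b a a' s t. holder_ball \<alpha> R b \<Longrightarrow> holder_ball \<alpha> R a \<Longrightarrow> holder_ball \<alpha> R a' \<Longrightarrow>
         0 \<le> s \<Longrightarrow> s \<le> t \<Longrightarrow> t \<le> T \<Longrightarrow>
         norm ((\<sigma> t (a t) (b t) - \<sigma> t (a' t) (b t)) - (\<sigma> s (a s) (b s) - \<sigma> s (a' s) (b s)))
           \<le> L * ((t - s) powr \<alpha> * norm (a t - a' t) + norm ((a t - a' t) - (a s - a' s)))"
      using difference_in_second_argument[OF Dw(1)[OF True] loc_lipschitz_coeff_flip[OF Dw(2)[OF True]], of R]
      by blast
    show thesis by (rule that[OF L(1)]) (use L(2,3) in blast)+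
  next
    case False
    show thesis by (rule that[of 0]) (use False in auto)
  qed
  obtain S where S: "0 \<le> S" "\<And>a b. holder_ball \<alpha> R a \<Longrightarrow> holder_ball \<alpha> R b \<Longrightarrow> holder_ball \<alpha> S (\<lambda>t. \<sigma> t (a t) (b t))"
    using coefficient_along_paths[OF linear_growth_imp_loc_lipschitz[OF \<sigma>_growth], of R] by blast
  define L where "L = L1 + L2"
  have L: "0 \<le> L" "L1 \<le> L" "L2 \<le> L" using L1(1) L2(1) by (auto simp: L_def)
  obtain h where h: "0 < h" "h \<le> 1" "(1 + \<kappa>) * (5 * R * L + S) * h powr (\<beta> - \<alpha>) \<le> 1 / 2"
    by (rule small_step_exists)
  show thesis
  proof (rule that[OF h(1,2)])
    fix g g' w w' x x' y C N V D
    assume g: "holder_ball \<beta> R g" and w: "holder_ball \<alpha> R w" "holder_ball \<alpha> R w'"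
      and x: "holder_ball \<alpha> R x" "holder_ball \<alpha> R x'" and or: "w = w' \<or> smooth_w"
      and k: "holder_ball \<beta> D (\<lambda>t. g t - g' t)" and v: "holder_ball \<alpha> V (\<lambda>t. w t - w' t)"
      and y: "follows_germ C (\<lambda>s t. young_germ g w x s t - young_germ g' w' x' s t) y"
      and z: "weighted_holder h N (\<lambda>t. x t - x' t)"
    have V: "0 \<le> V" using holder_ball_nonneg[OF v] .
    define f1 where "f1 t = \<sigma> t (w t) (x t) - \<sigma> t (w t) (x' t)" for t
    define f2 where "f2 t = \<sigma> t (w t) (x' t) - \<sigma> t (w' t) (x' t)" for t
    show "weighted_holder h ((N + (norm (x 0 - x' 0) + V + D)) / 2) y"
    proof (rule weighted_holder_step[where f = "\<lambda>t. f1 t + f2 t", OF _ h g S(2)[OF w(2) x(2)] k z])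
      show "follows_germ C (\<lambda>s t. blinfun_apply (f1 s + f2 s) (g t - g s)
          + blinfun_apply (\<sigma> s (w' s) (x' s)) (g t - g' t - (g s - g' s))) y"
      proof -
        have "blinfun_apply (f1 s + f2 s) (g t - g s)
          + blinfun_apply (\<sigma> s (w' s) (x' s)) (g t - g' t - (g s - g' s))
          = young_germ g w x s t - young_germ g' w' x' s t" for s t
          by (simp add: f1_def f2_def blinfun.bilinear_simps)
        then show ?thesis using y by simp
      qed
      show "norm (f1 t + f2 t) \<le> L * (norm (x t - x' t) + V)" if t: "0 \<le> t" "t \<le> T" for t
      proof -
        have "norm (f1 t + f2 t) \<le> L1 * norm (x t - x' t) + L2 * norm (w t - w' t)"
          unfolding f1_def f2_def by (intro norm_triangle_mono L1(2) L2(2) w x or t)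
        also have "\<dots> \<le> L * norm (x t - x' t) + L * V"
          using L holder_ball_sup[OF v t] by (intro add_mono mult_mono) auto
        finally show ?thesis by (simp add: distrib_left)
      qed
      show "norm ((f1 t + f2 t) - (f1 s + f2 s)) \<le> L * ((t - s) powr \<alpha> * (norm (x s - x' s) + norm (x t - x' t) + 3 * V)
          + norm (x t - x' t - (x s - x' s)))" if st: "0 \<le> s" "s \<le> t" "t \<le> T" for s t
      proof -
        define e where "e = (t - s) powr \<alpha>"
        have e: "0 \<le> e" by (simp add: e_def)
        have "(f1 t + f2 t) - (f1 s + f2 s) = (f1 t - f1 s) + (f2 t - f2 s)" by simp
        also have "norm \<dots> \<le> L1 * (e * norm (x t - x' t) + norm (x t - x' t - (x s - x' s)))
            + L2 * (e * norm (w t - w' t) + norm (w t - w' t - (w s - w' s)))"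
          unfolding f1_def f2_def e_def by (intro norm_triangle_mono L1(3) L2(3) w x or st)
        also have "\<dots> \<le> L * (e * norm (x t - x' t) + norm (x t - x' t - (x s - x' s))) + L * (e * V + V * e)"
          using L holder_ball_sup[OF v, of t] holder_ball_increment[OF v st] st e
          by (intro add_mono mult_mono) (auto simp: e_def)
        also have "\<dots> = L * (e * (norm (x t - x' t) + 2 * V) + norm (x t - x' t - (x s - x' s)))"
          by (simp add: algebra_simps)
        also have "\<dots> \<le> L * (e * (norm (x s - x' s) + norm (x t - x' t) + 3 * V) + norm (x t - x' t - (x s - x' s)))"
          using L e V by (intro mult_left_mono add_mono) auto
        finally show ?thesis by (simp add: e_def)
      qed
    qed (use L V in auto)
  qed
qed

text \<open>The a priori bound confines both solutions to a ball that depends on \<open>R\<close> only; on that ball the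
contraction estimate, applied to the difference of the solutions itself, absorbs its own hypothesis.\<close>

lemma solutions_locally_lipschitz:
  fixes Dw :: "real \<Rightarrow> 'w \<Rightarrow> 'x \<Rightarrow> ('w \<Rightarrow>\<^sub>L ('v \<Rightarrow>\<^sub>L 'x))"
  assumes Dw: "\<And>t a b. smooth_w \<Longrightarrow> ((\<lambda>a. \<sigma> t a b) has_derivative blinfun_apply (Dw t a b)) (at a)"
    "smooth_w \<Longrightarrow> loc_lipschitz_coeff Dw"
  obtains K where "0 \<le> K"
    "\<And>g g' w w' x x' C C' V D S S'. holder_ball \<beta> R g \<Longrightarrow> holder_ball \<beta> R g' \<Longrightarrow>
       holder_ball \<alpha> R w \<Longrightarrow> holder_ball \<alpha> R w' \<Longrightarrow> norm (x 0) \<le> R \<Longrightarrow> norm (x' 0) \<le> R \<Longrightarrow>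
       holder_ball \<alpha> S x \<Longrightarrow> holder_ball \<alpha> S' x' \<Longrightarrow>
       follows_germ C (young_germ g w x) x \<Longrightarrow> follows_germ C' (young_germ g' w' x') x' \<Longrightarrow>
       w = w' \<or> smooth_w \<Longrightarrow>
       holder_ball \<beta> D (\<lambda>t. g t - g' t) \<Longrightarrow> holder_ball \<alpha> V (\<lambda>t. w t - w' t) \<Longrightarrow>
       holder_ball \<alpha> (K * (norm (x 0 - x' 0) + V + D)) (\<lambda>t. x t - x' t)"
proof -
  obtain R1 where R1: "\<And>g w x C S. holder_ball \<beta> R g \<Longrightarrow> holder_ball \<alpha> R w \<Longrightarrow> norm (x 0) \<le> R \<Longrightarrow>
       holder_ball \<alpha> S x \<Longrightarrow> follows_germ C (young_germ g w x) x \<Longrightarrow> holder_ball \<alpha> R1 x"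
    using a_priori_bound[of R] by blast
  define R2 where "R2 = max R R1"
  obtain h where h: "0 < h" "h \<le> 1" and step:
    "\<And>g g' w w' x x' y C N V D. holder_ball \<beta> R2 g \<Longrightarrow> holder_ball \<alpha> R2 w \<Longrightarrow> holder_ball \<alpha> R2 w' \<Longrightarrow>
       holder_ball \<alpha> R2 x \<Longrightarrow> holder_ball \<alpha> R2 x' \<Longrightarrow> w = w' \<or> smooth_w \<Longrightarrow>
       holder_ball \<beta> D (\<lambda>t. g t - g' t) \<Longrightarrow> holder_ball \<alpha> V (\<lambda>t. w t - w' t) \<Longrightarrow>
       follows_germ C (\<lambda>s t. young_germ g w x s t - young_germ g' w' x' s t) y \<Longrightarrow>
       weighted_holder h N (\<lambda>t. x t - x' t) \<Longrightarrow>
       weighted_holder h ((N + (norm (x 0 - x' 0) + V + D)) / 2) y"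
    using contraction_step[of smooth_w Dw R2, OF Dw] by blast
  define K where "K = 4 * exp (T / h) / h powr \<alpha> * 2"
  show thesis
  proof (rule that)
    show "0 \<le> K" using h by (simp add: K_def)
    fix g g' w w' x x' C C' V D S S'
    assume g: "holder_ball \<beta> R g" "holder_ball \<beta> R g'" and w: "holder_ball \<alpha> R w" "holder_ball \<alpha> R w'"
      and x0: "norm (x 0) \<le> R" "norm (x' 0) \<le> R" and x: "holder_ball \<alpha> S x" "holder_ball \<alpha> S' x'"
      and germ: "follows_germ C (young_germ g w x) x" "follows_germ C' (young_germ g' w' x') x'"
      and or: "w = w' \<or> smooth_w"
      and k: "holder_ball \<beta> D (\<lambda>t. g t - g' t)" and v: "holder_ball \<alpha> V (\<lambda>t. w t - w' t)"
    define b where "b = norm (x 0 - x' 0) + V + D"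
    have big: "R \<le> R2" "R1 \<le> R2" by (auto simp: R2_def)
    have x2: "holder_ball \<alpha> R2 x" "holder_ball \<alpha> R2 x'"
      using R1[OF g(1) w(1) x0(1) x(1) germ(1)] R1[OF g(2) w(2) x0(2) x(2) germ(2)] holder_ball_mono[OF _ big(2)]
      by blast+
    have "weighted_holder h b (\<lambda>t. x t - x' t)"
    proof (rule weighted_holder_absorb)
      show "weighted_holder h (R2 + R2) (\<lambda>t. x t - x' t)"
        by (rule holder_ball_imp_weighted[OF holder_ball_diff[OF x2] h(1)])
      show "weighted_holder h ((N + b) / 2) (\<lambda>t. x t - x' t)" if "weighted_holder h N (\<lambda>t. x t - x' t)" for N
        unfolding b_def
        by (rule step[OF _ _ _ x2 or k v follows_germ_diff[OF germ] that]) (use g w holder_ball_mono[OF _ big(1)] in blast)+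
    qed
    then have "holder_ball \<alpha> (4 * exp (T / h) / h powr \<alpha> * (norm (x 0 - x' 0) + b)) (\<lambda>t. x t - x' t)"
      by (rule weighted_imp_holder_ball[OF _ h])
    moreover have "norm (x 0 - x' 0) \<le> b"
      using holder_ball_nonneg[OF k] holder_ball_nonneg[OF v] by (simp add: b_def)
    then have "4 * exp (T / h) / h powr \<alpha> * (norm (x 0 - x' 0) + b) \<le> 4 * exp (T / h) / h powr \<alpha> * (2 * b)"
      by (intro mult_left_mono) auto
    ultimately have "holder_ball \<alpha> (4 * exp (T / h) / h powr \<alpha> * (2 * b)) (\<lambda>t. x t - x' t)"
      by (rule holder_ball_mono)
    then show "holder_ball \<alpha> (K * (norm (x 0 - x' 0) + V + D)) (\<lambda>t. x t - x' t)"
      by (simp only: K_def b_def mult.assoc)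
  qed
qed

text \<open>Picard iteration at two scales. At the scale \<open>h\<close> of the growth estimate the iterates stay in a fixed set,
hence in a fixed Hoelder ball; this ball determines the finer scale \<open>h2\<close> at which successive iterates
contract. Since all iterates follow their germs with one constant \<open>C\<close>, pointwise convergence is enough
to pass to the limit in the equation.\<close>

lemma solution_exists:
  assumes g: "holder_ball \<beta> R g" and w: "holder_ball \<alpha> R w"
  obtains x C S where "x 0 = a" "follows_germ C (young_germ g w x) x" "holder_ball \<alpha> S x"
proof -
  obtain h where h: "0 < h" "h \<le> 1" and step: "\<And>g w x y C N. holder_ball \<beta> R g \<Longrightarrow> holder_ball \<alpha> R w \<Longrightarrow>
       follows_germ C (young_germ g w x) y \<Longrightarrow> weighted_holder h N x \<Longrightarrow>
       weighted_holder h ((N + (norm (x 0) + 1)) / 2) y"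
    using growth_step[of R] by blast
  define B where "B x \<longleftrightarrow> x 0 = a \<and> weighted_holder h (norm a + 1) x" for x :: "real \<Rightarrow> 'x"
  define S where "S = max R (4 * exp (T / h) / h powr \<alpha> * (norm a + (norm a + 1)))"
  have S: "R \<le> S" by (simp add: S_def)
  have ball: "holder_ball \<alpha> S x" if "B x" for x
  proof -
    have x: "x 0 = a" "weighted_holder h (norm a + 1) x" using that by (auto simp: B_def)
    show ?thesis
      by (rule holder_ball_mono[OF weighted_imp_holder_ball[OF x(2) h]]) (simp add: S_def x(1))
  qed
  have gS: "holder_ball \<beta> S g" and wS: "holder_ball \<alpha> S w" using g w S holder_ball_mono by blast+
  obtain L where "0 \<le> L"
    and L: "\<And>u b. holder_ball \<alpha> S u \<Longrightarrow> holder_ball \<alpha> S b \<Longrightarrow> holder_ball \<alpha> L (\<lambda>t. \<sigma> t (u t) (b t))"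
    by (rule coefficient_along_paths[OF linear_growth_imp_loc_lipschitz[OF \<sigma>_growth], of S]) (rule that)
  define C where "C = \<kappa> * (L * R)"
  have "\<forall>x. \<exists>y. B x \<longrightarrow> B y \<and> follows_germ C (young_germ g w x) y"
  proof
    fix x show "\<exists>y. B x \<longrightarrow> B y \<and> follows_germ C (young_germ g w x) y"
    proof (cases "B x")
      case x: True
      obtain y where y: "y 0 = 0" "follows_germ C (young_germ g w x) y"
        unfolding C_def using young_sewing[OF L[OF wS ball[OF x]] g] by blast
      then have y': "follows_germ C (young_germ g w x) (\<lambda>t. a + y t)" by (simp add: follows_germ_def)
      have "weighted_holder h (norm a + 1) x" "x 0 = a" using x by (auto simp: B_def)
      \<comment> \<open>The bound \<open>norm a + 1\<close> is the fixed point of \<open>N \<mapsto> (N + (norm a + 1)) / 2\<close>, hence invariant.\<close>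
      then have "weighted_holder h ((norm a + 1 + (norm a + 1)) / 2) (\<lambda>t. a + y t)"
        using step[OF g w y'] by metis
      moreover have "(norm a + 1 + (norm a + 1)) / 2 = norm a + 1" by simp
      ultimately have "weighted_holder h (norm a + 1) (\<lambda>t. a + y t)" by (simp only:)
      then have "B (\<lambda>t. a + y t)" using y(1) by (simp add: B_def)
      then show ?thesis using y' by blast
    qed simp
  qed
  from choice[OF this] obtain \<Gamma> where "\<forall>x. B x \<longrightarrow> B (\<Gamma> x) \<and> follows_germ C (young_germ g w x) (\<Gamma> x)" ..
  then have \<Gamma>: "B (\<Gamma> x)" "follows_germ C (young_germ g w x) (\<Gamma> x)" if "B x" for x
    using that by simp_all
  define X where "X n = (\<Gamma> ^^ n) (\<lambda>_. a)" for n
  have "B (\<lambda>_. a)" using h by (simp add: B_def weighted_holder_def)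
  then have X1: "B (X n)" for n by (induction n) (auto simp: X_def \<Gamma>(1))
  have X2: "follows_germ C (young_germ g w (X n)) (X (Suc n))" for n
    using \<Gamma>(2)[OF X1[of n]] by (simp add: X_def)
  note X = X1 X2
  obtain h2 where h2: "0 < h2" "h2 \<le> 1" and step2:
    "\<And>g g' w w' x x' y C N V D. holder_ball \<beta> S g \<Longrightarrow> holder_ball \<alpha> S w \<Longrightarrow> holder_ball \<alpha> S w' \<Longrightarrow>
       holder_ball \<alpha> S x \<Longrightarrow> holder_ball \<alpha> S x' \<Longrightarrow> w = w' \<or> False \<Longrightarrow>
       holder_ball \<beta> D (\<lambda>t. g t - g' t) \<Longrightarrow> holder_ball \<alpha> V (\<lambda>t. w t - w' t) \<Longrightarrow>
       follows_germ C (\<lambda>s t. young_germ g w x s t - young_germ g' w' x' s t) y \<Longrightarrow>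
       weighted_holder h2 N (\<lambda>t. x t - x' t) \<Longrightarrow>
       weighted_holder h2 ((N + (norm (x 0 - x' 0) + V + D)) / 2) y"
    using contraction_step[of False "\<lambda>_ _ _. 0" S] by auto
  have contr: "weighted_holder h2 ((S + S) * (1 / 2) ^ n) (\<lambda>t. X (Suc n) t - X n t)" for n
  proof (induction n)
    case 0
    show ?case using holder_ball_imp_weighted[OF holder_ball_diff[OF ball[OF X(1)] ball[OF X(1)]] h2(1)] by simp
  next
    case (Suc n)
    have zero: "holder_ball \<beta> 0 (\<lambda>t. g t - g t)" "holder_ball \<alpha> 0 (\<lambda>t. w t - w t)"
      by (simp_all add: holder_ball_def)
    have "X (Suc n) 0 = a" "X n 0 = a" using X(1) by (auto simp: B_def)
    then show ?case
      using step2[OF gS wS wS ball[OF X(1)] ball[OF X(1)] _ zero follows_germ_diff[OF X(2) X(2)] Suc] by simp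
  qed
  have conv: "convergent (\<lambda>n. X n t)" if t: "0 \<le> t" "t \<le> T" for t
  proof -
    define c where "c = exp (t / h2) * (2 * h2 powr \<alpha> * (S + S))"
    have "norm (X (Suc n) t - X n t) \<le> c * (1 / 2) ^ n" for n
    proof -
      have "X (Suc n) 0 = a" "X n 0 = a" using X(1) by (auto simp: B_def)
      then show ?thesis using weighted_holder_sup[OF contr[of n] h2(1) t] by (simp add: c_def mult_ac)
    qed
    then have le: "norm (X (Suc n) t - X n t) \<le> c * (1 / 2) ^ n" if "n \<ge> 0" for n .
    have "summable (\<lambda>n. c * (1 / 2 :: real) ^ n)" by (intro summable_mult summable_geometric) simp
    from summable_comparison_test'[OF this le] have "summable (\<lambda>n. X (Suc n) t - X n t)" .
    then have "convergent (\<lambda>m. X m t - X 0 t)"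
      by (simp add: summable_iff_convergent sum_lessThan_telescope[where f = "\<lambda>n. X n t"])
    then have "convergent (\<lambda>m. X m t - X 0 t + X 0 t)"
      by (intro convergent_add convergent_const)
    then show ?thesis by simp
  qed
  define x where "x t = lim (\<lambda>n. X n t)" for t
  have lim: "(\<lambda>n. X n t) \<longlonglongrightarrow> x t" if "0 \<le> t" "t \<le> T" for t
    using conv[OF that] by (simp add: convergent_LIMSEQ_iff x_def)
  have "x 0 = a" using X(1) by (simp add: x_def B_def)
  moreover have "follows_germ C (young_germ g w x) x"
    unfolding follows_germ_def
  proof (intro allI impI)
    fix s t assume st: "0 \<le> s" "s \<le> t" "t \<le> T"
    have "(\<lambda>n. \<sigma> s (w s) (X n s)) \<longlonglongrightarrow> \<sigma> s (w s) (x s)"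
      by (rule isCont_tendsto_compose[OF has_derivative_continuous[OF Dx] lim]) (use st in auto)
    then have "(\<lambda>n. norm (X (Suc n) t - X (Suc n) s - young_germ g w (X n) s t)) \<longlonglongrightarrow>
        norm (x t - x s - young_germ g w x s t)"
      using LIMSEQ_Suc[OF lim[of s]] LIMSEQ_Suc[OF lim[of t]] st
      by (intro tendsto_norm tendsto_diff blinfun.tendsto tendsto_const) auto
    then show "norm (x t - x s - young_germ g w x s t) \<le> C * (t - s) powr \<theta>"
      by (rule LIMSEQ_le_const2) (use follows_germD[OF X(2) st] in auto)
  qed
  moreover have "holder_ball \<alpha> S x"
    unfolding holder_ball_def
  proof (intro conjI allI impI)
    fix t assume "0 \<le> t" "t \<le> T"
    then show "norm (x t) \<le> S"
      using holder_ball_sup[OF ball[OF X(1)]] by (intro LIMSEQ_le_const2[OF tendsto_norm[OF lim]]) auto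
  next
    fix s t assume st: "0 \<le> s" "s \<le> t" "t \<le> T"
    have "(\<lambda>n. norm (X n t - X n s)) \<longlonglongrightarrow> norm (x t - x s)"
      using st by (intro tendsto_intros lim) auto
    then show "norm (x t - x s) \<le> S * (t - s) powr \<alpha>"
      by (rule LIMSEQ_le_const2) (use holder_ball_increment[OF ball[OF X(1)] st] in auto)
  qed
  ultimately show thesis by (rule that)
qed

end

section \<open>Hoelder spaces and the solution map\<close>

context young_exponents
begin

lemma holder_space_imp_ball:
  assumes f: "f \<in> holder_space \<gamma> T"
  shows "holder_ball \<gamma> (holder_norm \<gamma> T f) f"
proof -
  have b1: "bdd_above ((\<lambda>s. norm (f s)) ` {0..T})" and b2: "bdd_above (holder_quotients \<gamma> T f)"
    using f by (auto simp: holder_space_def)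
  have sup: "norm (f t) \<le> sup_norm T f" if "0 \<le> t" "t \<le> T" for t
    unfolding sup_norm_def using that by (intro cSUP_upper b1) auto
  have quot: "norm (f t - f s) / \<bar>t - s\<bar> powr \<gamma> \<le> Sup (holder_quotients \<gamma> T f)"
    if "0 \<le> s" "s < t" "t \<le> T" for s t
  proof (rule cSup_upper[OF _ b2])
    show "norm (f t - f s) / \<bar>t - s\<bar> powr \<gamma> \<in> holder_quotients \<gamma> T f"
      unfolding holder_quotients_def using that by (intro CollectI exI[of _ s] exI[of _ t]) auto
  qed
  have S1: "0 \<le> sup_norm T f" using order.trans[OF norm_ge_zero sup[of 0]] T_pos by simp
  have "0 \<le> norm (f T - f 0) / \<bar>T - 0\<bar> powr \<gamma>" by simp
  also have "\<dots> \<le> Sup (holder_quotients \<gamma> T f)" using T_pos by (intro quot) auto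
  finally have S2: "0 \<le> Sup (holder_quotients \<gamma> T f)" .
  show ?thesis
    unfolding holder_ball_def holder_norm_def
  proof (intro conjI allI impI)
    show "norm (f t) \<le> sup_norm T f + Sup (holder_quotients \<gamma> T f)" if "0 \<le> t" "t \<le> T" for t
      using sup[OF that] S2 by simp
    fix s t assume st: "0 \<le> s" "s \<le> t" "t \<le> T"
    show "norm (f t - f s) \<le> (sup_norm T f + Sup (holder_quotients \<gamma> T f)) * (t - s) powr \<gamma>"
    proof (cases "s = t")
      case False
      then have "norm (f t - f s) \<le> Sup (holder_quotients \<gamma> T f) * (t - s) powr \<gamma>"
        using quot[of s t] st by (simp add: pos_divide_le_eq)
      also have "\<dots> \<le> (sup_norm T f + Sup (holder_quotients \<gamma> T f)) * (t - s) powr \<gamma>"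
        using S1 by (intro mult_right_mono) auto
      finally show ?thesis .
    qed simp
  qed
qed

lemma holder_ball_quotient:
  assumes f: "holder_ball \<gamma> R f" and q: "q \<in> holder_quotients \<gamma> T f"
  shows "q \<le> R"
proof -
  obtain s t where q: "q = norm (f t - f s) / \<bar>t - s\<bar> powr \<gamma>" and st: "s \<in> {0..T}" "t \<in> {0..T}" "s \<noteq> t"
    using q by (auto simp: holder_quotients_def)
  have "norm (f t - f s) \<le> R * \<bar>t - s\<bar> powr \<gamma>"
    using holder_ball_increment[OF f, of s t] holder_ball_increment[OF f, of t s] st
    by (cases "s \<le> t") (auto simp: norm_minus_commute)
  then show ?thesis using st by (simp add: q pos_divide_le_eq)
qed

lemma holder_ball_imp_norm_le:
  assumes f: "holder_ball \<gamma> R f"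
  shows "holder_norm \<gamma> T f \<le> 2 * R"
proof -
  have "sup_norm T f \<le> R"
    unfolding sup_norm_def using holder_ball_sup[OF f] T_pos by (intro cSUP_least) auto
  moreover have "Sup (holder_quotients \<gamma> T f) \<le> R"
  proof (rule cSup_least)
    have "norm (f T - f 0) / \<bar>T - 0\<bar> powr \<gamma> \<in> holder_quotients \<gamma> T f"
      using T_pos unfolding holder_quotients_def by (intro CollectI exI[of _ 0] exI[of _ T]) auto
    then show "holder_quotients \<gamma> T f \<noteq> {}" by blast
  qed (rule holder_ball_quotient[OF f])
  ultimately show ?thesis by (simp add: holder_norm_def)
qed

lemma holder_ball_imp_holder_space:
  assumes "holder_ball \<gamma> R f" and "\<And>t. t \<notin> {0..T} \<Longrightarrow> f t = 0"
  shows "f \<in> holder_space \<gamma> T"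
  using assms holder_ball_sup[OF assms(1)] holder_ball_quotient[OF assms(1)]
  by (auto simp: holder_space_def intro!: bdd_aboveI)

lemma holder_space_diff:
  assumes "f \<in> holder_space \<gamma> T" "g \<in> holder_space \<gamma> T"
  shows "f - g \<in> holder_space \<gamma> T"
proof (rule holder_ball_imp_holder_space)
  show "holder_ball \<gamma> (holder_norm \<gamma> T f + holder_norm \<gamma> T g) (f - g)"
    using holder_ball_diff[OF assms[THEN holder_space_imp_ball]] by (simp add: fun_diff_def)
qed (use assms in \<open>auto simp: holder_space_def\<close>)

lemma holder_norm_nonneg: "f \<in> holder_space \<gamma> T \<Longrightarrow> 0 \<le> holder_norm \<gamma> T f"
  using holder_ball_nonneg holder_space_imp_ball by blast

text \<open>Turns closeness in norm to a fixed centre into a bound with a common radius.\<close>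

lemma holder_space_neighbour:
  assumes "f \<in> holder_space \<gamma> T" "g \<in> holder_space \<gamma> T" "holder_norm \<gamma> T (f - g) \<le> 1" "holder_norm \<gamma> T g + 1 \<le> R"
  shows "holder_ball \<gamma> R f"
proof -
  have "holder_ball \<gamma> (holder_norm \<gamma> T (f - g) + holder_norm \<gamma> T g) f"
    using holder_space_imp_ball[OF holder_space_diff[OF assms(1,2)]] holder_space_imp_ball[OF assms(2)]
    by (intro holder_ball_add) (simp_all add: fun_diff_def)
  then show ?thesis by (rule holder_ball_mono) (use assms(3,4) in linarith)
qed

end

context young_equation
begin

text \<open>A solution has Hoelder regular integrand, so sewing provides an indefinite integral, and uniqueness of
limits of Riemann sums identifies it with the solution.\<close>

lemma young_solution_iff_follows_germ:
  assumes g: "g \<in> holder_space \<beta> T" and w: "w \<in> holder_space \<alpha> T"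
  shows "young_solution \<alpha> T \<sigma> g w a x \<longleftrightarrow>
    x \<in> holder_space \<alpha> T \<and> x 0 = a \<and> (\<exists>C. follows_germ C (young_germ g w x) x)"
proof (intro iffI conjI; (elim conjE)?)
  assume sol: "young_solution \<alpha> T \<sigma> g w a x"
  then show xs: "x \<in> holder_space \<alpha> T" by (simp add: young_solution_def)
  define R where "R = max (holder_norm \<alpha> T w) (holder_norm \<alpha> T x)"
  have wx: "holder_ball \<alpha> R w" "holder_ball \<alpha> R x"
    by (rule holder_ball_mono[OF holder_space_imp_ball[OF w]], simp add: R_def)
      (rule holder_ball_mono[OF holder_space_imp_ball[OF xs]], simp add: R_def)
  obtain L where "0 \<le> L"
    and L: "\<And>u b. holder_ball \<alpha> R u \<Longrightarrow> holder_ball \<alpha> R b \<Longrightarrow> holder_ball \<alpha> L (\<lambda>t. \<sigma> t (u t) (b t))"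
    by (rule coefficient_along_paths[OF linear_growth_imp_loc_lipschitz[OF \<sigma>_growth], of R]) (rule that)
  obtain y where y: "y 0 = 0" "follows_germ (\<kappa> * (L * holder_norm \<beta> T g)) (young_germ g w x) y"
    by (rule young_sewing[OF L[OF wx] holder_space_imp_ball[OF g]])
  have xy: "x t = a + y t" if t: "0 \<le> t" "t \<le> T" for t
  proof -
    obtain I where "has_young_integral (\<lambda>s. \<sigma> s (w s) (x s)) g 0 t I" "x t = a + I"
      using sol[unfolded young_solution_def, THEN conjunct2, rule_format, of t] t by auto
    then show ?thesis
      using has_young_integral_unique[OF _ follows_germ_has_young_integral[OF y(2) t]] y(1) by simp
  qed
  then show "x 0 = a" using T_pos y(1) by simp
  have "follows_germ (\<kappa> * (L * holder_norm \<beta> T g)) (young_germ g w x) x"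
    using y(2) by (simp add: follows_germ_def xy)
  then show "\<exists>C. follows_germ C (young_germ g w x) x" ..
next
  assume x: "x \<in> holder_space \<alpha> T" "x 0 = a" "\<exists>C. follows_germ C (young_germ g w x) x"
  then obtain C where C: "follows_germ C (young_germ g w x) x" by blast
  have "\<exists>I. has_young_integral (\<lambda>s. \<sigma> s (w s) (x s)) g 0 t I \<and> x t = a + I" if "t \<in> {0..T}" for t
    using follows_germ_has_young_integral[OF C, of t] that x(2) by (intro exI[of _ "x t - x 0"]) simp
  with x(1) show "young_solution \<alpha> T \<sigma> g w a x" by (simp add: young_solution_def)
qed

lemma solution_unique_exists:
  assumes g: "g \<in> holder_space \<beta> T" and w: "w \<in> holder_space \<alpha> T"
  shows "\<exists>!x. young_solution \<alpha> T \<sigma> g w a x"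
proof -
  define R where "R = max (max (holder_norm \<beta> T g) (holder_norm \<alpha> T w)) (norm a)"
  have gR: "holder_ball \<beta> R g" and wR: "holder_ball \<alpha> R w" and aR: "norm a \<le> R"
    by (rule holder_ball_mono[OF holder_space_imp_ball[OF g]], simp add: R_def)
      (rule holder_ball_mono[OF holder_space_imp_ball[OF w]], simp_all add: R_def)
  obtain x C S where x: "x 0 = a" "follows_germ C (young_germ g w x) x" "holder_ball \<alpha> S x"
    by (rule solution_exists[OF gR wR])
  define x' where "x' t = (if t \<in> {0..T} then x t else 0)" for t
  have "x' \<in> holder_space \<alpha> T"
    by (rule holder_ball_imp_holder_space[of _ S]) (use x(3) in \<open>auto simp: x'_def holder_ball_def\<close>)
  moreover have "follows_germ C (young_germ g w x') x'"
    using x(2) by (simp add: follows_germ_def x'_def)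
  moreover have "x' 0 = a" using x(1) T_pos by (simp add: x'_def)
  ultimately have ex: "young_solution \<alpha> T \<sigma> g w a x'"
    using young_solution_iff_follows_germ[OF g w] by blast
  obtain K where "0 \<le> K" and K: "\<And>g g' w w' x x' C C' V D S S'. holder_ball \<beta> R g \<Longrightarrow> holder_ball \<beta> R g' \<Longrightarrow>
       holder_ball \<alpha> R w \<Longrightarrow> holder_ball \<alpha> R w' \<Longrightarrow> norm (x 0) \<le> R \<Longrightarrow> norm (x' 0) \<le> R \<Longrightarrow>
       holder_ball \<alpha> S x \<Longrightarrow> holder_ball \<alpha> S' x' \<Longrightarrow>
       follows_germ C (young_germ g w x) x \<Longrightarrow> follows_germ C' (young_germ g' w' x') x' \<Longrightarrow>
       w = w' \<or> False \<Longrightarrow>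
       holder_ball \<beta> D (\<lambda>t. g t - g' t) \<Longrightarrow> holder_ball \<alpha> V (\<lambda>t. w t - w' t) \<Longrightarrow>
       holder_ball \<alpha> (K * (norm (x 0 - x' 0) + V + D)) (\<lambda>t. x t - x' t)"
    by (rule solutions_locally_lipschitz[of False "\<lambda>_ _ _. 0" R]) (simp, simp, rule that)
  have zero: "holder_ball \<gamma> 0 (\<lambda>t. h t - h t)" for \<gamma> and h :: "real \<Rightarrow> 'c::real_normed_vector"
    by (simp add: holder_ball_def)
  have "y = z" if sol: "young_solution \<alpha> T \<sigma> g w a y" "young_solution \<alpha> T \<sigma> g w a z" for y z
  proof -
    obtain C1 C2 where y: "y \<in> holder_space \<alpha> T" "y 0 = a" "follows_germ C1 (young_germ g w y) y"
      and z: "z \<in> holder_space \<alpha> T" "z 0 = a" "follows_germ C2 (young_germ g w z) z"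
      using sol[THEN young_solution_iff_follows_germ[OF g w, THEN iffD1]] by blast
    have "holder_ball \<alpha> (K * (norm (y 0 - z 0) + 0 + 0)) (\<lambda>t. y t - z t)"
      by (rule K[OF gR gR wR wR _ _ holder_space_imp_ball[OF y(1)] holder_space_imp_ball[OF z(1)] y(3) z(3) _ zero zero])
        (use y z aR in auto)
    then have "y t = z t" if "0 \<le> t" "t \<le> T" for t
      using holder_ball_sup[of \<alpha> _ "\<lambda>t. y t - z t" t] that y z by fastforce
    moreover have "y t = z t" if "\<not> (0 \<le> t \<and> t \<le> T)" for t
      using y(1) z(1) that by (simp add: holder_space_def)
    ultimately show "y = z" by blast
  qed
  with ex show ?thesis by blast
qed

text \<open>The parameter term of the bound is set to \<open>0\<close> for \<open>w = w'\<close>, so that one statement serves both for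
joint dependence on \<open>(g, w, a)\<close> and for dependence on \<open>(g, a)\<close> with fixed \<open>w\<close>.\<close>

lemma solution_map_locally_lipschitz:
  fixes Dw :: "real \<Rightarrow> 'w \<Rightarrow> 'x \<Rightarrow> ('w \<Rightarrow>\<^sub>L ('v \<Rightarrow>\<^sub>L 'x))"
  assumes Dw: "\<And>t a b. smooth_w \<Longrightarrow> ((\<lambda>a. \<sigma> t a b) has_derivative blinfun_apply (Dw t a b)) (at a)"
    "smooth_w \<Longrightarrow> loc_lipschitz_coeff Dw"
  obtains K where
    "\<And>g g' w w' a a'. g \<in> holder_space \<beta> T \<Longrightarrow> g' \<in> holder_space \<beta> T \<Longrightarrow>
       w \<in> holder_space \<alpha> T \<Longrightarrow> w' \<in> holder_space \<alpha> T \<Longrightarrow>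
       holder_ball \<beta> R g \<Longrightarrow> holder_ball \<beta> R g' \<Longrightarrow> holder_ball \<alpha> R w \<Longrightarrow> holder_ball \<alpha> R w' \<Longrightarrow>
       norm a \<le> R \<Longrightarrow> norm a' \<le> R \<Longrightarrow> w = w' \<or> smooth_w \<Longrightarrow>
       holder_norm \<alpha> T (young_solution_map \<alpha> T \<sigma> g w a - young_solution_map \<alpha> T \<sigma> g' w' a')
         \<le> K * (holder_norm \<beta> T (g - g') + (if w = w' then 0 else holder_norm \<alpha> T (w - w')) + norm (a - a'))"
proof -
  obtain K where K: "0 \<le> K"
    "\<And>g g' w w' x x' C C' V D S S'. holder_ball \<beta> R g \<Longrightarrow> holder_ball \<beta> R g' \<Longrightarrow>
       holder_ball \<alpha> R w \<Longrightarrow> holder_ball \<alpha> R w' \<Longrightarrow> norm (x 0) \<le> R \<Longrightarrow> norm (x' 0) \<le> R \<Longrightarrow>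
       holder_ball \<alpha> S x \<Longrightarrow> holder_ball \<alpha> S' x' \<Longrightarrow>
       follows_germ C (young_germ g w x) x \<Longrightarrow> follows_germ C' (young_germ g' w' x') x' \<Longrightarrow>
       w = w' \<or> smooth_w \<Longrightarrow>
       holder_ball \<beta> D (\<lambda>t. g t - g' t) \<Longrightarrow> holder_ball \<alpha> V (\<lambda>t. w t - w' t) \<Longrightarrow>
       holder_ball \<alpha> (K * (norm (x 0 - x' 0) + V + D)) (\<lambda>t. x t - x' t)"
    using solutions_locally_lipschitz[of smooth_w Dw R, OF Dw] by blast
  show thesis
  proof (rule that)
    fix g g' :: "real \<Rightarrow> 'v" and w w' :: "real \<Rightarrow> 'w" and a a' :: 'x
    assume g: "g \<in> holder_space \<beta> T" "g' \<in> holder_space \<beta> T"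
      and w: "w \<in> holder_space \<alpha> T" "w' \<in> holder_space \<alpha> T"
      and R: "holder_ball \<beta> R g" "holder_ball \<beta> R g'" "holder_ball \<alpha> R w" "holder_ball \<alpha> R w'"
        "norm a \<le> R" "norm a' \<le> R" and or: "w = w' \<or> smooth_w"
    define x where "x = young_solution_map \<alpha> T \<sigma> g w a"
    define x' where "x' = young_solution_map \<alpha> T \<sigma> g' w' a'"
    define V where "V = (if w = w' then 0 else holder_norm \<alpha> T (w - w'))"
    have "young_solution \<alpha> T \<sigma> g w a x" "young_solution \<alpha> T \<sigma> g' w' a' x'"
      unfolding x_def x'_def young_solution_map_def
      using theI'[OF solution_unique_exists[OF g(1) w(1)]] theI'[OF solution_unique_exists[OF g(2) w(2)]]
      by blast+
    then obtain C C' where x: "x \<in> holder_space \<alpha> T" "x 0 = a" "follows_germ C (young_germ g w x) x"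
      and x': "x' \<in> holder_space \<alpha> T" "x' 0 = a'" "follows_germ C' (young_germ g' w' x') x'"
      using young_solution_iff_follows_germ[OF g(1) w(1)] young_solution_iff_follows_germ[OF g(2) w(2)]
      by auto
    have D: "holder_ball \<beta> (holder_norm \<beta> T (g - g')) (\<lambda>t. g t - g' t)"
      using holder_space_imp_ball[OF holder_space_diff[OF g]] by (simp add: fun_diff_def)
    have V: "holder_ball \<alpha> V (\<lambda>t. w t - w' t)"
    proof (cases "w = w'")
      case False
      then show ?thesis
        using holder_space_imp_ball[OF holder_space_diff[OF w]] by (simp add: V_def fun_diff_def)
    qed (simp add: V_def holder_ball_def)
    have "holder_ball \<alpha> (K * (norm (x 0 - x' 0) + V + holder_norm \<beta> T (g - g'))) (\<lambda>t. x t - x' t)"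
      by (rule K(2)[OF R(1-4) _ _ holder_space_imp_ball[OF x(1)] holder_space_imp_ball[OF x'(1)] x(3) x'(3) or D V])
        (use R x x' in auto)
    from holder_ball_imp_norm_le[OF this]
    have "holder_norm \<alpha> T (x - x') \<le> 2 * (K * (norm (a - a') + V + holder_norm \<beta> T (g - g')))"
      using x(2) x'(2) by (simp add: fun_diff_def)
    then show "holder_norm \<alpha> T (young_solution_map \<alpha> T \<sigma> g w a - young_solution_map \<alpha> T \<sigma> g' w' a')
         \<le> (2 * K) * (holder_norm \<beta> T (g - g') + (if w = w' then 0 else holder_norm \<alpha> T (w - w')) + norm (a - a'))"
      by (simp add: x_def x'_def V_def algebra_simps)
  qed
qed

end

lemma norm_le_of_close:
  fixes a b :: "'a::real_normed_vector"
  assumes "norm (a - b) \<le> 1" "norm b + 1 \<le> R"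
  shows "norm a \<le> R"
  using norm_triangle_sub[of a b] assms by linarith

theorem corollary4p7:
  fixes T \<alpha> \<beta> :: real
    and \<sigma> :: "real \<Rightarrow> 'w::banach \<Rightarrow> 'x::banach \<Rightarrow> ('v::banach \<Rightarrow>\<^sub>L 'x)"
  assumes "T > 0"
    and "1/2 < \<beta>" and "\<beta> \<le> 1"
    and "1/2 < \<alpha>" and "\<alpha> < \<beta>"
    and "alpha_nice \<alpha> \<sigma>"
  shows "(\<forall>g\<in>holder_space \<beta> T. \<forall>w\<in>holder_space \<alpha> T. \<forall>a. \<exists>!x. young_solution \<alpha> T \<sigma> g w a x) \<and>
    (nice_condition_d \<alpha> \<sigma> \<longrightarrow>
       locally_lipschitz_map (holder_space \<beta> T \<times> holder_space \<alpha> T \<times> UNIV)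
         (\<lambda>(g, w, a). holder_norm \<beta> T g + holder_norm \<alpha> T w + norm a) (holder_norm \<alpha> T)
         (\<lambda>(g, w, a). young_solution_map \<alpha> T \<sigma> g w a)) \<and>
    (\<forall>w\<in>holder_space \<alpha> T.
       locally_lipschitz_map (holder_space \<beta> T \<times> UNIV)
         (\<lambda>(g, a). holder_norm \<beta> T g + norm a) (holder_norm \<alpha> T)
         (\<lambda>(g, a). young_solution_map \<alpha> T \<sigma> g w a))"
proof -
  interpret young_exponents T \<alpha> \<beta> by unfold_locales (use assms in auto)
  obtain M Dx c d where M: "\<And>t w x. norm (\<sigma> t w x) \<le> M"
    and Dx: "\<And>t w x. ((\<lambda>y. \<sigma> t w y) has_derivative blinfun_apply (Dx t w x)) (at x)"
    and c: "continuous_on UNIV c" "nice_space_bound c \<sigma>" "nice_space_bound c Dx"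
    and d: "continuous_on UNIV d" "nice_time_bound \<alpha> d \<sigma>" "nice_time_bound \<alpha> d Dx"
    using \<open>alpha_nice \<alpha> \<sigma>\<close> unfolding alpha_nice_def by blast
  interpret young_equation T \<alpha> \<beta> \<sigma> Dx M
    by unfold_locales
      (use M Dx c d nice_bounds_imp_linear_growth linear_growth_imp_loc_lipschitz in blast)+
  show ?thesis
  proof (intro conjI impI ballI allI)
    show "\<exists>!x. young_solution \<alpha> T \<sigma> g w a x" if "g \<in> holder_space \<beta> T" "w \<in> holder_space \<alpha> T" for g w a
      using solution_unique_exists that .
  next
    assume "nice_condition_d \<alpha> \<sigma>"
    then obtain Dw c d where Dw: "\<And>t w x. ((\<lambda>z. \<sigma> t z x) has_derivative blinfun_apply (Dw t w x)) (at w)"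
      and cd: "continuous_on UNIV c" "continuous_on UNIV d"
        "\<And>t w w' x x'. norm (Dw t w x - Dw t w' x') \<le>
              c (t, norm w, norm w', norm x, norm x') * (norm (x - x') + norm (w - w'))"
        "\<And>t s w x. norm (Dw t w x - Dw s w x) \<le> d (norm w, norm x) * \<bar>t - s\<bar> powr \<alpha>"
      unfolding nice_condition_d_def by blast
    have Dw': "loc_lipschitz_coeff Dw" by (rule condition_d_bounds_imp_loc_lipschitz[OF cd])
    show "locally_lipschitz_map (holder_space \<beta> T \<times> holder_space \<alpha> T \<times> UNIV)
         (\<lambda>(g, w, a). holder_norm \<beta> T g + holder_norm \<alpha> T w + norm a) (holder_norm \<alpha> T)
         (\<lambda>(g, w, a). young_solution_map \<alpha> T \<sigma> g w a)"
      unfolding locally_lipschitz_map_def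
    proof
      fix p :: "(real \<Rightarrow> 'v) \<times> (real \<Rightarrow> 'w) \<times> 'x"
      assume "p \<in> holder_space \<beta> T \<times> holder_space \<alpha> T \<times> UNIV"
      then obtain g0 w0 a0 where p: "p = (g0, w0, a0)" "g0 \<in> holder_space \<beta> T" "w0 \<in> holder_space \<alpha> T" by auto
      define R where "R = holder_norm \<beta> T g0 + holder_norm \<alpha> T w0 + norm a0 + 1"
      have R: "holder_norm \<beta> T g0 + 1 \<le> R" "holder_norm \<alpha> T w0 + 1 \<le> R" "norm a0 + 1 \<le> R"
        using holder_norm_nonneg[OF p(2)] holder_norm_nonneg[OF p(3)] norm_ge_zero[of a0] unfolding R_def by linarith+
      obtain K where K: "\<And>g g' w w' a a'. g \<in> holder_space \<beta> T \<Longrightarrow> g' \<in> holder_space \<beta> T \<Longrightarrow>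
         w \<in> holder_space \<alpha> T \<Longrightarrow> w' \<in> holder_space \<alpha> T \<Longrightarrow>
         holder_ball \<beta> R g \<Longrightarrow> holder_ball \<beta> R g' \<Longrightarrow> holder_ball \<alpha> R w \<Longrightarrow> holder_ball \<alpha> R w' \<Longrightarrow>
         norm a \<le> R \<Longrightarrow> norm a' \<le> R \<Longrightarrow> w = w' \<or> True \<Longrightarrow>
         holder_norm \<alpha> T (young_solution_map \<alpha> T \<sigma> g w a - young_solution_map \<alpha> T \<sigma> g' w' a')
           \<le> K * (holder_norm \<beta> T (g - g') + (if w = w' then 0 else holder_norm \<alpha> T (w - w')) + norm (a - a'))"
        by (rule solution_map_locally_lipschitz[of True Dw R, OF Dw Dw']) (rule that)
      show "\<exists>r>0. \<exists>L. \<forall>q\<in>holder_space \<beta> T \<times> holder_space \<alpha> T \<times> UNIV. \<forall>q'\<in>holder_space \<beta> T \<times> holder_space \<alpha> T \<times> UNIV.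
          (case q - p of (g, w, a) \<Rightarrow> holder_norm \<beta> T g + holder_norm \<alpha> T w + norm a) < r \<and>
          (case q' - p of (g, w, a) \<Rightarrow> holder_norm \<beta> T g + holder_norm \<alpha> T w + norm a) < r \<longrightarrow>
          holder_norm \<alpha> T ((case q of (g, w, a) \<Rightarrow> young_solution_map \<alpha> T \<sigma> g w a) - (case q' of (g, w, a) \<Rightarrow> young_solution_map \<alpha> T \<sigma> g w a))
            \<le> L * (case q - q' of (g, w, a) \<Rightarrow> holder_norm \<beta> T g + holder_norm \<alpha> T w + norm a)"
      proof (rule exI[of _ 1], rule conjI[OF zero_less_one], rule exI[of _ "\<bar>K\<bar>"], intro ballI impI, elim conjE)
        fix q q' :: "(real \<Rightarrow> 'v) \<times> (real \<Rightarrow> 'w) \<times> 'x"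
        assume "q \<in> holder_space \<beta> T \<times> holder_space \<alpha> T \<times> UNIV" "q' \<in> holder_space \<beta> T \<times> holder_space \<alpha> T \<times> UNIV"
        then obtain g w a g' w' a' where q: "q = (g, w, a)" "q' = (g', w', a')"
          and mem: "g \<in> holder_space \<beta> T" "w \<in> holder_space \<alpha> T" "g' \<in> holder_space \<beta> T" "w' \<in> holder_space \<alpha> T"
          by auto
        assume "(case q - p of (g, w, a) \<Rightarrow> holder_norm \<beta> T g + holder_norm \<alpha> T w + norm a) < 1"
          "(case q' - p of (g, w, a) \<Rightarrow> holder_norm \<beta> T g + holder_norm \<alpha> T w + norm a) < 1"
        then have less: "holder_norm \<beta> T (g - g0) + holder_norm \<alpha> T (w - w0) + norm (a - a0) < 1"
          "holder_norm \<beta> T (g' - g0) + holder_norm \<alpha> T (w' - w0) + norm (a' - a0) < 1"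
          by (simp_all add: q p)
        have close: "holder_norm \<beta> T (g - g0) \<le> 1" "holder_norm \<alpha> T (w - w0) \<le> 1" "norm (a - a0) \<le> 1"
          "holder_norm \<beta> T (g' - g0) \<le> 1" "holder_norm \<alpha> T (w' - w0) \<le> 1" "norm (a' - a0) \<le> 1"
          using less holder_norm_nonneg[OF holder_space_diff[OF mem(1) p(2)]] holder_norm_nonneg[OF holder_space_diff[OF mem(2) p(3)]]
            holder_norm_nonneg[OF holder_space_diff[OF mem(3) p(2)]] holder_norm_nonneg[OF holder_space_diff[OF mem(4) p(3)]]
            norm_ge_zero[of "a - a0"] norm_ge_zero[of "a' - a0"] by linarith+
        define N where "N = holder_norm \<beta> T (g - g') + (if w = w' then 0 else holder_norm \<alpha> T (w - w')) + norm (a - a')"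
        have "holder_norm \<alpha> T (young_solution_map \<alpha> T \<sigma> g w a - young_solution_map \<alpha> T \<sigma> g' w' a') \<le> K * N"
          unfolding N_def
          by (intro K mem disjI2 TrueI holder_space_neighbour[OF _ p(2) _ R(1)] holder_space_neighbour[OF _ p(3) _ R(2)]
              norm_le_of_close[OF _ R(3)] close)
        also have "\<dots> \<le> \<bar>K\<bar> * (holder_norm \<beta> T (g - g') + holder_norm \<alpha> T (w - w') + norm (a - a'))"
          using holder_norm_nonneg[OF holder_space_diff[OF mem(1,3)]] holder_norm_nonneg[OF holder_space_diff[OF mem(2,4)]]
          by (intro mult_mono) (auto simp: N_def)
        finally show "holder_norm \<alpha> T ((case q of (g, w, a) \<Rightarrow> young_solution_map \<alpha> T \<sigma> g w a) - (case q' of (g, w, a) \<Rightarrow> young_solution_map \<alpha> T \<sigma> g w a))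
            \<le> \<bar>K\<bar> * (case q - q' of (g, w, a) \<Rightarrow> holder_norm \<beta> T g + holder_norm \<alpha> T w + norm a)"
          by (simp add: q)
      qed
    qed
  next
    fix w :: "real \<Rightarrow> 'w" assume w: "w \<in> holder_space \<alpha> T"
    show "locally_lipschitz_map (holder_space \<beta> T \<times> UNIV)
         (\<lambda>(g, a). holder_norm \<beta> T g + norm a) (holder_norm \<alpha> T)
         (\<lambda>(g, a). young_solution_map \<alpha> T \<sigma> g w a)"
      unfolding locally_lipschitz_map_def
    proof
      fix p :: "(real \<Rightarrow> 'v) \<times> 'x"
      assume "p \<in> holder_space \<beta> T \<times> UNIV"
      then obtain g0 a0 where p: "p = (g0, a0)" "g0 \<in> holder_space \<beta> T" by auto
      define R where "R = holder_norm \<beta> T g0 + holder_norm \<alpha> T w + norm a0 + 1"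
      have R: "holder_norm \<beta> T g0 + 1 \<le> R" "holder_norm \<alpha> T w \<le> R" "norm a0 + 1 \<le> R"
        using holder_norm_nonneg[OF p(2)] holder_norm_nonneg[OF w] norm_ge_zero[of a0] unfolding R_def by linarith+
      have wR: "holder_ball \<alpha> R w" by (rule holder_ball_mono[OF holder_space_imp_ball[OF w] R(2)])
      obtain K where K: "\<And>g g' w w' a a'. g \<in> holder_space \<beta> T \<Longrightarrow> g' \<in> holder_space \<beta> T \<Longrightarrow>
         w \<in> holder_space \<alpha> T \<Longrightarrow> w' \<in> holder_space \<alpha> T \<Longrightarrow>
         holder_ball \<beta> R g \<Longrightarrow> holder_ball \<beta> R g' \<Longrightarrow> holder_ball \<alpha> R w \<Longrightarrow> holder_ball \<alpha> R w' \<Longrightarrow>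
         norm a \<le> R \<Longrightarrow> norm a' \<le> R \<Longrightarrow> w = w' \<or> False \<Longrightarrow>
         holder_norm \<alpha> T (young_solution_map \<alpha> T \<sigma> g w a - young_solution_map \<alpha> T \<sigma> g' w' a')
           \<le> K * (holder_norm \<beta> T (g - g') + (if w = w' then 0 else holder_norm \<alpha> T (w - w')) + norm (a - a'))"
        by (rule solution_map_locally_lipschitz[of False "\<lambda>_ _ _. 0" R]) (simp, simp, rule that)
      show "\<exists>r>0. \<exists>L. \<forall>q\<in>holder_space \<beta> T \<times> UNIV. \<forall>q'\<in>holder_space \<beta> T \<times> UNIV.
          (case q - p of (g, a) \<Rightarrow> holder_norm \<beta> T g + norm a) < r \<and>
          (case q' - p of (g, a) \<Rightarrow> holder_norm \<beta> T g + norm a) < r \<longrightarrow>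
          holder_norm \<alpha> T ((case q of (g, a) \<Rightarrow> young_solution_map \<alpha> T \<sigma> g w a) - (case q' of (g, a) \<Rightarrow> young_solution_map \<alpha> T \<sigma> g w a))
            \<le> L * (case q - q' of (g, a) \<Rightarrow> holder_norm \<beta> T g + norm a)"
      proof (rule exI[of _ 1], rule conjI[OF zero_less_one], rule exI[of _ K], intro ballI impI, elim conjE)
        fix q q' :: "(real \<Rightarrow> 'v) \<times> 'x"
        assume "q \<in> holder_space \<beta> T \<times> UNIV" "q' \<in> holder_space \<beta> T \<times> UNIV"
        then obtain g a g' a' where q: "q = (g, a)" "q' = (g', a')"
          and mem: "g \<in> holder_space \<beta> T" "g' \<in> holder_space \<beta> T"
          by auto
        assume "(case q - p of (g, a) \<Rightarrow> holder_norm \<beta> T g + norm a) < 1"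
          "(case q' - p of (g, a) \<Rightarrow> holder_norm \<beta> T g + norm a) < 1"
        then have less: "holder_norm \<beta> T (g - g0) + norm (a - a0) < 1" "holder_norm \<beta> T (g' - g0) + norm (a' - a0) < 1"
          by (simp_all add: q p)
        have close: "holder_norm \<beta> T (g - g0) \<le> 1" "norm (a - a0) \<le> 1"
          "holder_norm \<beta> T (g' - g0) \<le> 1" "norm (a' - a0) \<le> 1"
          using less holder_norm_nonneg[OF holder_space_diff[OF mem(1) p(2)]]
            holder_norm_nonneg[OF holder_space_diff[OF mem(2) p(2)]]
            norm_ge_zero[of "a - a0"] norm_ge_zero[of "a' - a0"] by linarith+
        have "holder_norm \<alpha> T (young_solution_map \<alpha> T \<sigma> g w a - young_solution_map \<alpha> T \<sigma> g' w a')
           \<le> K * (holder_norm \<beta> T (g - g') + (if w = w then 0 else holder_norm \<alpha> T (w - w)) + norm (a - a'))"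
          by (intro K mem w wR disjI1 refl holder_space_neighbour[OF _ p(2) _ R(1)] norm_le_of_close[OF _ R(3)] close)
        then show "holder_norm \<alpha> T ((case q of (g, a) \<Rightarrow> young_solution_map \<alpha> T \<sigma> g w a) - (case q' of (g, a) \<Rightarrow> young_solution_map \<alpha> T \<sigma> g w a))
            \<le> K * (case q - q' of (g, a) \<Rightarrow> holder_norm \<beta> T g + norm a)"
          by (simp add: q)
      qed
    qed
  qed
qed

end
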